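(* Let $t,u\in\mathfrak S_n$ with $t\le_W u$. Then for all $v,w\in\mathfrak S_n$ and every reduced expression $s_{i_1}\cdots s_{i_k}$ for $ut^{-1}$, $$r_{u,v,t,w}(q_1)=p_{u,v,t,w}(q_1;s_{i_1}\cdots s_{i_k}).$$ In particular $p_{u,v,t,w}(q_1;s_{i_1}\cdots s_{i_k})$ does not depend on the chosen reduced expression.
   Context: $\mathfrak S_n$ is generated by adjacent transpositions $s_1,\dots,s_{n-1}$; the one-line notation $w_1\cdots w_n$ of $w$ is obtained by letting an expression for $w$ act on the word $1\cdots n$, $s_j$ swapping letters in positions $j,j+1$. $\le$ is Bruhat order, $\le_W$ the weak order ($u\le_W v$ iff some reduced expression of $v$ ends with a reduced expression of $u$). The quantum matrix bialgebra $\mathcal A$ is the associative unital $\mathbb Z[q^{1/2},q^{-1/2}]$-algebra generated by $x_{i,j}$ ($1\le i,j\le n$) with relations, for $i<j$, $k<\ell$: $x_{i,\ell}x_{i,k}=q^{1/2}x_{i,k}x_{i,\ell}$, $x_{j,k}x_{i,\ell}=x_{i,\ell}x_{j,k}$, $x_{j,k}x_{i,k}=q^{1/2}x_{i,k}x_{j,k}$, $x_{j,\ell}x_{i,k}=x_{i,k}x_{j,\ell}+(q^{1/2}-q^{-1/2})x_{i,\ell}x_{j,k}$. Put $x^{u,v}=x_{u_1,v_1}\cdots x_{u_n,v_n}$. For fixed $t$, $\{x^{t,w}\}_{w\in\mathfrak S_n}$ is a basis of the span of all $x^{u,v}$, and for $t\le_W u$ there are unique polynomials $r_{u,v,t,w}(q_1)\in\mathbb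 N[q_1]$ with $x^{u,v}=\sum_w r_{u,v,t,w}(q^{1/2}-q^{-1/2})x^{t,w}$. For a reduced expression $s_{i_1}\cdots s_{i_k}$ of $ut^{-1}$, $C^b_{u,v,t,w}(s_{i_1}\cdots s_{i_k})$ is the set of sequences $(\pi^{(0)},\dots,\pi^{(k)})$ with $\pi^{(0)}=v$, $\pi^{(k)}=w$, $\pi^{(j)}\in\{s_{i_j}\pi^{(j-1)},\pi^{(j-1)}\}$, $\pi^{(j)}=s_{i_j}\pi^{(j-1)}$ whenever $s_{i_j}\pi^{(j-1)}>\pi^{(j-1)}$, and $\pi^{(j)}=\pi^{(j-1)}$ for exactly $b$ indices $j$; and $p_{u,v,t,w}(q_1;s_{i_1}\cdots s_{i_k})=\sum_b|C^b_{u,v,t,w}(s_{i_1}\cdots s_{i_k})|q_1^b$. *)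

theory Defs
  imports
    "HOL-Library.Poly_Mapping"
    "HOL-Library.Sublist"
    "HOL-Computational_Algebra.Polynomial"
    "HOL-Combinatorics.Permutations"
    "HOL-Algebra.QuotRing"
begin

section \<open>The symmetric group\<close>

text \<open>
  Elements of the symmetric group are functions \<open>w\<close> with \<open>w permutes {1..n}\<close>, multiplied by
  ordinary composition.
\<close>

definition adj :: "nat \<Rightarrow> nat \<Rightarrow> nat" where
  "adj j = transpose j (Suc j)"

definition word_perm :: "nat list \<Rightarrow> nat \<Rightarrow> nat" where
  "word_perm js = foldr (\<lambda>j w. adj j \<circ> w) js id"

definition expr_for :: "nat \<Rightarrow> nat list \<Rightarrow> (nat \<Rightarrow> nat) \<Rightarrow> bool" where
  "expr_for n js w \<longleftrightarrow> set js \<subseteq> {1..<n} \<and> word_perm js = w"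

definition reduced_expr :: "nat \<Rightarrow> nat list \<Rightarrow> (nat \<Rightarrow> nat) \<Rightarrow> bool" where
  "reduced_expr n js w \<longleftrightarrow>
     expr_for n js w \<and> (\<forall>js'. expr_for n js' w \<longrightarrow> length js \<le> length js')"

definition weak_le :: "nat \<Rightarrow> (nat \<Rightarrow> nat) \<Rightarrow> (nat \<Rightarrow> nat) \<Rightarrow> bool" where
  "weak_le n u v \<longleftrightarrow> (\<exists>as bs. reduced_expr n (as @ bs) v \<and> reduced_expr n bs u)"

definition bruhat_le :: "nat \<Rightarrow> (nat \<Rightarrow> nat) \<Rightarrow> (nat \<Rightarrow> nat) \<Rightarrow> bool" where
  "bruhat_le n u v \<longleftrightarrow>
     (\<exists>as bs. reduced_expr n as u \<and> reduced_expr n bs v \<and> subseq as bs)"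

definition bruhat_less :: "nat \<Rightarrow> (nat \<Rightarrow> nat) \<Rightarrow> (nat \<Rightarrow> nat) \<Rightarrow> bool" where
  "bruhat_less n u v \<longleftrightarrow> bruhat_le n u v \<and> u \<noteq> v"

text \<open>
  \<open>one_line w i\<close> is the \<open>i\<close>-th letter of the one-line notation. A word is a function from positions
  to letters, so swapping the letters in positions \<open>j\<close> and \<open>j + 1\<close> is precomposition with
  \<open>adj j\<close>. Letting \<open>s\<^sub>j\<^sub>1 \<cdots> s\<^sub>j\<^sub>k\<close> act on \<open>1 \<cdots> n\<close> (last factor first) therefore
  produces the inverse of \<open>s\<^sub>j\<^sub>1 \<circ> \<cdots> \<circ> s\<^sub>j\<^sub>k\<close>; see \<open>one_line_word_perm\<close>.
\<close>

definition one_line :: "(nat \<Rightarrow> nat) \<Rightarrow> nat \<Rightarrow> nat" where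
  "one_line w = Hilbert_Choice.inv w"

lemma bij_word_perm: "bij (word_perm js)"
proof (induction js)
  case Nil
  show ?case by (simp add: word_perm_def bij_id[unfolded id_def] id_def)
next
  case (Cons j js)
  have "bij (adj j \<circ> word_perm js)"
    by (rule bij_comp[OF Cons]) (simp add: adj_def)
  then show ?case by (simp add: word_perm_def comp_def)
qed

lemma one_line_word_perm:
  "one_line (word_perm js) = foldr (\<lambda>j a. a \<circ> adj j) js id"
proof (induction js)
  case Nil
  show ?case by (simp add: one_line_def word_perm_def)
next
  case (Cons j js)
  have "one_line (word_perm (j # js)) = Hilbert_Choice.inv (adj j \<circ> word_perm js)"
    by (simp add: one_line_def word_perm_def)
  also have "\<dots> = Hilbert_Choice.inv (word_perm js) \<circ> Hilbert_Choice.inv (adj j)"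
    by (rule o_inv_distrib) (simp_all add: bij_word_perm adj_def)
  finally show ?case using Cons by (simp add: one_line_def adj_def)
qed


section \<open>The quantum matrix bialgebra\<close>

text \<open>
  The ring of Laurent polynomials in \<open>q\<^sup>1\<^sup>/\<^sup>2\<close> with integer coefficients, as the group ring of the
  additive group of integers: the exponent \<open>k\<close> stands for \<open>q\<^sup>k\<^sup>/\<^sup>2\<close>.
\<close>

type_synonym laurent = "int \<Rightarrow>\<^sub>0 int"

definition qh :: laurent where "qh = Poly_Mapping.single 1 1"

definition qh_inv :: laurent where "qh_inv = Poly_Mapping.single (-1) 1"

text \<open>
  The free monoid, written additively so that \<open>'a fmonoid \<Rightarrow>\<^sub>0 'b\<close> with its convolution product
  is the free associative algebra.
\<close>

datatype 'a fmonoid = Word (letters: "'a list")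

instantiation fmonoid :: (type) monoid_add
begin

definition zero_fmonoid :: "'a fmonoid" where
  "zero_fmonoid = Word []"

definition plus_fmonoid :: "'a fmonoid \<Rightarrow> 'a fmonoid \<Rightarrow> 'a fmonoid" where
  "plus_fmonoid a b = Word (letters a @ letters b)"

instance
  by standard (simp_all add: zero_fmonoid_def plus_fmonoid_def)

end

type_synonym free_alg = "(nat \<times> nat) fmonoid \<Rightarrow>\<^sub>0 laurent"

definition gen :: "nat \<Rightarrow> nat \<Rightarrow> free_alg" where
  "gen i j = Poly_Mapping.single (Word [(i, j)]) 1"

definition const :: "laurent \<Rightarrow> free_alg" where
  "const c = Poly_Mapping.single (Word []) c"

definition free_ring :: "nat \<Rightarrow> free_alg ring" where
  "free_ring n =
     \<lparr>carrier = {f. \<forall>m \<in> Poly_Mapping.keys f. set (letters m) \<subseteq> {1..n} \<times> {1..n}},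
      mult = (*), one = 1, zero = 0, add = (+)\<rparr>"

lemma ring_free_ring: "ring (free_ring n)"
proof (rule ringI)
  show "abelian_group (free_ring n)"
  proof (rule abelian_groupI)
    fix x y assume "x \<in> carrier (free_ring n)" "y \<in> carrier (free_ring n)"
    then show "x \<oplus>\<^bsub>free_ring n\<^esub> y \<in> carrier (free_ring n)"
      using Poly_Mapping.keys_add[of x y] by (fastforce simp: free_ring_def)
  next
    fix x assume "x \<in> carrier (free_ring n)"
    then show "\<exists>y \<in> carrier (free_ring n). y \<oplus>\<^bsub>free_ring n\<^esub> x = \<zero>\<^bsub>free_ring n\<^esub>"
      by (intro bexI[of _ "- x"]) (auto simp: free_ring_def)
  qed (auto simp: free_ring_def ac_simps)
  show "monoid (free_ring n)"
  proof (rule monoidI)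
    fix x y assume "x \<in> carrier (free_ring n)" "y \<in> carrier (free_ring n)"
    then show "x \<otimes>\<^bsub>free_ring n\<^esub> y \<in> carrier (free_ring n)"
      using keys_mult[of x y] by (fastforce simp: free_ring_def plus_fmonoid_def)
  qed (auto simp: free_ring_def ac_simps zero_fmonoid_def keys_one)
qed (auto simp: free_ring_def algebra_simps)

definition qmat_relators :: "nat \<Rightarrow> free_alg set" where
  "qmat_relators n =
     {gen i l * gen i k - const qh * gen i k * gen i l | i k l.
        i \<in> {1..n} \<and> k \<in> {1..n} \<and> l \<in> {1..n} \<and> k < l} \<union>
     {gen j k * gen i l - gen i l * gen j k | i j k l.
        i \<in> {1..n} \<and> j \<in> {1..n} \<and> k \<in> {1..n} \<and> l \<in> {1..n} \<and> i < j \<and> k < l} \<union>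
     {gen j k * gen i k - const qh * gen i k * gen j k | i j k.
        i \<in> {1..n} \<and> j \<in> {1..n} \<and> k \<in> {1..n} \<and> i < j} \<union>
     {gen j l * gen i k - (gen i k * gen j l + const (qh - qh_inv) * gen i l * gen j k) | i j k l.
        i \<in> {1..n} \<and> j \<in> {1..n} \<and> k \<in> {1..n} \<and> l \<in> {1..n} \<and> i < j \<and> k < l}"

definition qmat_ideal :: "nat \<Rightarrow> free_alg set" where
  "qmat_ideal n = Idl\<^bsub>free_ring n\<^esub> (qmat_relators n)"

definition qmat :: "nat \<Rightarrow> free_alg set ring" where
  "qmat n = free_ring n Quot qmat_ideal n"

definition qvar :: "nat \<Rightarrow> nat \<Rightarrow> nat \<Rightarrow> free_alg set" where
  "qvar n i j = qmat_ideal n +>\<^bsub>free_ring n\<^esub> gen i j"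

definition qscale :: "nat \<Rightarrow> laurent \<Rightarrow> free_alg set \<Rightarrow> free_alg set" where
  "qscale n c a = (qmat_ideal n +>\<^bsub>free_ring n\<^esub> const c) \<otimes>\<^bsub>qmat n\<^esub> a"

definition xmon :: "nat \<Rightarrow> (nat \<Rightarrow> nat) \<Rightarrow> (nat \<Rightarrow> nat) \<Rightarrow> free_alg set" where
  "xmon n u v =
     foldr (\<lambda>i a. qvar n (one_line u i) (one_line v i) \<otimes>\<^bsub>qmat n\<^esub> a) [1..<Suc n] \<one>\<^bsub>qmat n\<^esub>"


section \<open>The two families of polynomials\<close>

definition eval_q1 :: "nat poly \<Rightarrow> laurent" where
  "eval_q1 f = poly (map_poly of_nat f) (qh - qh_inv)"

text \<open>
  The family is set to \<open>0\<close> off the symmetric group, so that it is determined as a total function.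
\<close>

definition r_poly ::
    "nat \<Rightarrow> (nat \<Rightarrow> nat) \<Rightarrow> (nat \<Rightarrow> nat) \<Rightarrow> (nat \<Rightarrow> nat) \<Rightarrow> (nat \<Rightarrow> nat) \<Rightarrow> nat poly" where
  "r_poly n u v t =
     (THE r. (\<forall>w. \<not> w permutes {1..n} \<longrightarrow> r w = 0) \<and>
        xmon n u v =
          (\<Oplus>\<^bsub>qmat n\<^esub> w \<in> {w. w permutes {1..n}}. qscale n (eval_q1 (r w)) (xmon n t w)))"

text \<open>
  The permutations \<open>u\<close> and \<open>t\<close> enter the set \<open>C\<^sup>b\<^sub>u\<^sub>,\<^sub>v\<^sub>,\<^sub>t\<^sub>,\<^sub>w\<close> only through the expression \<open>js\<close>
  for \<open>u t\<^sup>-\<^sup>1\<close>. The list index \<open>j\<close> starts at \<open>0\<close>, so \<open>js ! j\<close> is the letter used in the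
  step from \<open>\<pi> ! j\<close> to \<open>\<pi> ! Suc j\<close>.
\<close>

definition C_set ::
    "nat \<Rightarrow> nat \<Rightarrow> (nat \<Rightarrow> nat) \<Rightarrow> (nat \<Rightarrow> nat) \<Rightarrow> nat list \<Rightarrow> (nat \<Rightarrow> nat) list set" where
  "C_set n b v w js =
     {\<pi>. length \<pi> = Suc (length js) \<and> \<pi> ! 0 = v \<and> \<pi> ! length js = w \<and>
         (\<forall>j < length js.
            \<pi> ! Suc j \<in> {adj (js ! j) \<circ> \<pi> ! j, \<pi> ! j} \<and>
            (bruhat_less n (\<pi> ! j) (adj (js ! j) \<circ> \<pi> ! j) \<longrightarrow>
               \<pi> ! Suc j = adj (js ! j) \<circ> \<pi> ! j)) \<and>
         card {j. j < length js \<and> \<pi> ! Suc j = \<pi> ! j} = b}"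

definition p_poly :: "nat \<Rightarrow> (nat \<Rightarrow> nat) \<Rightarrow> (nat \<Rightarrow> nat) \<Rightarrow> nat list \<Rightarrow> nat poly" where
  "p_poly n v w js = (\<Sum>b \<le> length js. monom (card (C_set n b v w js)) b)"

end

theory Submission
  imports Defs
begin

text \<open>
  In the multidegree where every row and every column occurs once, the defining relations of the
  quantum matrix bialgebra say that \<open>x\<^sup>u\<^sup>,\<^sup>v \<mapsto> T\<^bsub>u\<inverse>\<^esub> T\<^sub>v\<close> is well defined into the Hecke algebra with
  \<open>T\<^sub>s\<^sup>2 = 1 + q\<^sub>1 T\<^sub>s\<close>: for \<open>s u > u\<close>, moving \<open>s\<close> from \<open>u\<close> to \<open>v\<close> is multiplication of \<open>T\<^sub>v\<close> by \<open>T\<^sub>s\<close>.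
  Unfolding this along a reduced expression of \<open>u t\<^sup>-\<^sup>1\<close> expands \<open>x\<^sup>u\<^sup>,\<^sup>v\<close> in the \<open>x\<^sup>t\<^sup>,\<^sup>w\<close> with the path
  polynomials as coefficients. Conversely, multiplication by \<open>T\<^bsub>t\<inverse>\<^esub>\<close> is injective, so the \<open>x\<^sup>t\<^sup>,\<^sup>w\<close>
  are linearly independent and the expansion is unique.
\<close>

section \<open>Inversions and reduced expressions\<close>

lemma bij_adj [simp]: "bij (adj j)"
  by (simp add: adj_def)

lemma adj_adj [simp]: "adj j (adj j i) = i"
  by (simp add: adj_def)

lemma adj_comp_adj_comp [simp]: "adj j \<circ> (adj j \<circ> w) = w" "w \<circ> adj j \<circ> adj j = w"
  by (simp_all add: fun_eq_iff)

lemma inv_adj [simp]: "Hilbert_Choice.inv (adj j) = adj j"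
  by (simp add: adj_def)

lemma adj_values [simp]: "adj j j = Suc j" "adj j (Suc j) = j"
  by (simp_all add: adj_def)

lemma adj_other: "i \<noteq> j \<Longrightarrow> i \<noteq> Suc j \<Longrightarrow> adj j i = i"
  by (simp add: adj_def)

lemma adj_comp_neq: "bij w \<Longrightarrow> adj j \<circ> w \<noteq> w"
proof
  assume w: "bij w" "adj j \<circ> w = w"
  obtain x where "w x = j" using w(1) by (metis bij_pointE)
  with w(2) show False by (metis adj_values(1) comp_apply n_not_Suc_n)
qed

lemma adj_permutes: "j \<in> {1..<n} \<Longrightarrow> adj j permutes {1..n}"
  unfolding adj_def by (rule permutes_swap_id) auto

lemma adj_comp_permutes:
  "j \<in> {1..<n} \<Longrightarrow> w permutes {1..n} \<Longrightarrow> adj j \<circ> w permutes {1..n}"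
  by (intro permutes_compose adj_permutes)

lemma adj_comp_bij: "bij w \<Longrightarrow> bij (adj j \<circ> w)"
  by (simp add: bij_comp)

lemma word_perm_Nil [simp]: "word_perm [] = id"
  by (simp add: word_perm_def)

lemma word_perm_Cons [simp]: "word_perm (j # js) = adj j \<circ> word_perm js"
  by (simp add: word_perm_def)

lemma word_perm_append: "word_perm (as @ bs) = word_perm as \<circ> word_perm bs"
  by (induction as) (simp_all add: comp_assoc)

lemma word_perm_rev: "word_perm (rev js) = Hilbert_Choice.inv (word_perm js)"
proof (induction js)
  case (Cons j js)
  have "Hilbert_Choice.inv (word_perm (j # js)) = Hilbert_Choice.inv (word_perm js) \<circ> adj j"
    by (simp only: word_perm_Cons o_inv_distrib[OF bij_adj bij_word_perm] inv_adj)
  then show ?case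
    by (simp only: rev.simps word_perm_append Cons.IH word_perm_Cons word_perm_Nil comp_id)
qed simp

lemma word_perm_permutes: "set js \<subseteq> {1..<n} \<Longrightarrow> word_perm js permutes {1..n}"
proof (induction js)
  case (Cons j js)
  then show ?case
    unfolding word_perm_Cons by (intro adj_comp_permutes) auto
qed (simp add: permutes_id)

text \<open>Left multiplication by \<open>adj j\<close> swaps the letters in positions j and j+1 of
  the one-line word, so this is a local test for s_j w > w.\<close>

definition asc :: "nat \<Rightarrow> (nat \<Rightarrow> nat) \<Rightarrow> bool" where
  "asc j w \<longleftrightarrow> one_line w j < one_line w (Suc j)"

lemma one_line_adj_comp: "bij w \<Longrightarrow> one_line (adj j \<circ> w) = one_line w \<circ> adj j"
  by (simp add: one_line_def o_inv_distrib)

lemma bij_one_line: "bij w \<Longrightarrow> bij (one_line w)"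
  by (simp add: one_line_def bij_imp_bij_inv)

lemma asc_adj_comp: "bij w \<Longrightarrow> asc j (adj j \<circ> w) \<longleftrightarrow> \<not> asc j w"
proof -
  assume w: "bij w"
  then have "one_line w j \<noteq> one_line w (Suc j)"
    by (metis bij_one_line bij_is_inj injD n_not_Suc_n)
  then show ?thesis using w by (auto simp: asc_def one_line_adj_comp)
qed

section \<open>The inversion number and its change under an adjacent swap\<close>

definition inversions :: "nat \<Rightarrow> (nat \<Rightarrow> nat) \<Rightarrow> (nat \<times> nat) set" where
  "inversions n w = {(i, k). i \<in> {1..n} \<and> k \<in> {1..n} \<and> i < k \<and> one_line w k < one_line w i}"

lemma finite_inversions [simp]: "finite (inversions n w)"
  by (rule finite_subset[of _ "{1..n} \<times> {1..n}"]) (auto simp: inversions_def)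

text \<open>Relabelling positions by \<open>adj j\<close> preserves the order of every pair of
  positions except (j, j+1). Hence the inversions of w carry over bijectively, and the swapped
  ascent is the one new inversion.\<close>

lemma card_inversions_asc:
  assumes w: "bij w" and j: "j \<in> {1..<n}" and a: "asc j w"
  shows "card (inversions n (adj j \<circ> w)) = Suc (card (inversions n w))"
proof -
  let ?s = "map_prod (adj j) (adj j)"
  have ran: "adj j i \<in> {1..n} \<longleftrightarrow> i \<in> {1..n}" for i
    using permutes_in_image[OF adj_permutes[OF j]] .
  have less: "adj j i < adj j k" if "i < k" "\<not> (i = j \<and> k = Suc j)" for i k
    using that by (auto simp: adj_def transpose_def)
  have "inversions n (adj j \<circ> w) = insert (j, Suc j) (?s ` inversions n w)"
  proof (rule Set.set_eqI)
    fix p :: "nat \<times> nat"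
    obtain i k where p: "p = (i, k)" by (cases p)
    have "(i, k) \<in> ?s ` inversions n w \<longleftrightarrow> (adj j i, adj j k) \<in> inversions n w"
    proof
      assume "(adj j i, adj j k) \<in> inversions n w"
      then have "?s (adj j i, adj j k) \<in> ?s ` inversions n w" by (rule imageI)
      then show "(i, k) \<in> ?s ` inversions n w" by simp
    qed auto
    moreover have "(i, k) \<in> inversions n (adj j \<circ> w) \<longleftrightarrow>
        (i, k) = (j, Suc j) \<or> (adj j i, adj j k) \<in> inversions n w"
    proof (cases "(i, k) = (j, Suc j)")
      case True
      then show ?thesis
        using a j by (auto simp: inversions_def one_line_adj_comp[OF w] asc_def)
    next
      case False
      then have "i < k \<longleftrightarrow> adj j i < adj j k"
        if "one_line w (adj j k) < one_line w (adj j i)"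
        using less[of i k] less[of "adj j i" "adj j k"] a that
        by (cases "adj j i = j \<and> adj j k = Suc j") (auto simp: asc_def)
      then show ?thesis
        using False ran[of i] ran[of k]
        by (auto simp: inversions_def one_line_adj_comp[OF w])
    qed
    ultimately show "p \<in> inversions n (adj j \<circ> w) \<longleftrightarrow>
        p \<in> insert (j, Suc j) (?s ` inversions n w)" using p by simp
  qed
  \<comment> \<open>Its only preimage under the relabelling is the wrongly ordered pair (j+1,
    j).\<close>
  moreover have "(j, Suc j) \<notin> ?s ` inversions n w"
    by (auto simp: inversions_def adj_def transpose_def split: if_splits)
  moreover have "inj ?s"
    by (metis bij_adj bij_is_inj prod.inj_map)
  ultimately show ?thesis
    by (simp add: card_image inj_on_subset)
qed

lemma card_inversions_desc:
  assumes w: "bij w" and j: "j \<in> {1..<n}" and a: "\<not> asc j w"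
  shows "card (inversions n w) = Suc (card (inversions n (adj j \<circ> w)))"
  using card_inversions_asc[of "adj j \<circ> w" j n] assms by (simp add: asc_adj_comp adj_comp_bij)

lemma asc_iff_card_inversions:
  assumes "bij w" "j \<in> {1..<n}"
  shows "asc j w \<longleftrightarrow> card (inversions n w) < card (inversions n (adj j \<circ> w))"
  using card_inversions_asc[OF assms] card_inversions_desc[OF assms] by (cases "asc j w") auto

lemma inversions_id [simp]: "inversions n id = {}"
  by (auto simp: inversions_def one_line_def)

section \<open>Reduced expressions and the inversion number\<close>

lemma card_inversions_word_perm_comp_le:
  assumes "set js \<subseteq> {1..<n}" "bij w"
  shows "card (inversions n (word_perm js \<circ> w)) \<le> length js + card (inversions n w)"
  using assms(1)
proof (induction js)
  case (Cons j js)
  have b: "bij (word_perm js \<circ> w)" by (intro bij_comp bij_word_perm assms)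
  have j: "j \<in> {1..<n}" using Cons by simp
  have "card (inversions n (adj j \<circ> (word_perm js \<circ> w)))
      \<le> Suc (card (inversions n (word_perm js \<circ> w)))"
    using card_inversions_asc[OF b j] card_inversions_desc[OF b j]
    by (cases "asc j (word_perm js \<circ> w)") auto
  moreover have "card (inversions n (word_perm js \<circ> w)) \<le> length js + card (inversions n w)"
    using Cons by (simp add: comp_def)
  ultimately show ?case
    by (simp only: word_perm_Cons comp_assoc list.size)
qed simp

text \<open>A strictly increasing word over 1..n has each letter at least as large as its position,
  and a permutation with this property is the identity.\<close>

lemma permutes_all_asc_imp_id:
  assumes w: "w permutes {1..n}" and a: "\<And>j. j \<in> {1..<n} \<Longrightarrow> asc j w"
  shows "w = id"
proof -
  have p: "one_line w permutes {1..n}"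
    unfolding one_line_def by (rule permutes_inv[OF w])
  have "i \<le> one_line w i" if "i \<in> {1..n}" for i
    using that
  proof (induction i)
    case (Suc i)
    show ?case
    proof (cases "i = 0")
      case True
      have "one_line w (Suc i) \<in> {1..n}" using permutes_in_image[OF p] Suc.prems by blast
      then show ?thesis using True by simp
    next
      case False
      then have "i \<le> one_line w i" "asc i w" using Suc by (auto intro!: a)
      then show ?thesis by (simp add: asc_def)
    qed
  qed simp
  then have "one_line w = id" by (intro permutes_natset_ge[OF p]) auto
  then show ?thesis
    by (metis inv_inv_eq inv_id one_line_def permutes_bij[OF w])
qed

text \<open>Sorting: undoing a descent removes exactly one inversion and contributes one letter,
  until no descent is left.\<close>

lemma expr_for_card_inversions_exists:
  "w permutes {1..n} \<Longrightarrow> \<exists>js. expr_for n js w \<and> length js = card (inversions n w)"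
proof (induction "card (inversions n w)" arbitrary: w rule: less_induct)
  case less
  show ?case
  proof (cases "\<exists>j \<in> {1..<n}. \<not> asc j w")
    case True
    then obtain j where j: "j \<in> {1..<n}" "\<not> asc j w" by blast
    note c = card_inversions_desc[OF permutes_bij[OF less.prems] j]
    obtain js where js: "expr_for n js (adj j \<circ> w)" "length js = card (inversions n (adj j \<circ> w))"
      using less.hyps[of "adj j \<circ> w"] c adj_comp_permutes[OF j(1) less.prems] by auto
    then show ?thesis using j c
      by (intro exI[of _ "j # js"]) (auto simp: expr_for_def)
  next
    case False
    then have "w = id" using permutes_all_asc_imp_id[OF less.prems] by blast
    then show ?thesis by (intro exI[of _ "[]"]) (simp add: expr_for_def)
  qed
qed

lemma expr_for_permutes: "expr_for n js w \<Longrightarrow> w permutes {1..n}"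
  using word_perm_permutes by (auto simp: expr_for_def)

text \<open>A letter adds at most one inversion, which bounds the length from below; sorting attains
  the bound.\<close>

lemma reduced_expr_iff:
  "reduced_expr n js w \<longleftrightarrow> expr_for n js w \<and> length js = card (inversions n w)"
proof -
  have "card (inversions n w) \<le> length js'" if "expr_for n js' w" for js'
    using card_inversions_word_perm_comp_le[of js' n id] that by (auto simp: expr_for_def)
  then show ?thesis
    unfolding reduced_expr_def
    using expr_for_card_inversions_exists[OF expr_for_permutes[of n js w]]
    by (metis le_antisym)
qed

lemma reduced_expr_exists: "w permutes {1..n} \<Longrightarrow> \<exists>js. reduced_expr n js w"
  using expr_for_card_inversions_exists by (auto simp: reduced_expr_iff)

lemma reduced_expr_Cons:
  assumes "w permutes {1..n}" "j \<in> {1..<n}" "asc j w" "reduced_expr n js w"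
  shows "reduced_expr n (j # js) (adj j \<circ> w)"
  using assms card_inversions_asc[OF permutes_bij, of w "{1..n}" j n]
  by (auto simp: reduced_expr_iff expr_for_def)

text \<open>The tail has at most as many inversions as letters, so the first letter must create an
  inversion for the total to come out.\<close>

lemma reduced_expr_ConsD:
  assumes "reduced_expr n (j # js) w"
  shows "reduced_expr n js (word_perm js)" "asc j (word_perm js)" "j \<in> {1..<n}"
proof -
  have s: "set js \<subseteq> {1..<n}" and j: "j \<in> {1..<n}"
    and w: "w = adj j \<circ> word_perm js" and l: "Suc (length js) = card (inversions n w)"
    using assms by (auto simp: reduced_expr_iff expr_for_def)
  have le: "card (inversions n (word_perm js)) \<le> length js"
    using card_inversions_word_perm_comp_le[OF s bij_id] by simp
  then show a: "asc j (word_perm js)"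
    using l w by (simp add: asc_iff_card_inversions[OF bij_word_perm j])
  show "reduced_expr n js (word_perm js)"
    using card_inversions_asc[OF bij_word_perm j a] l w s
    by (simp add: reduced_expr_iff expr_for_def)
  show "j \<in> {1..<n}" by (rule j)
qed

lemma reduced_expr_rev:
  assumes "reduced_expr n js w"
  shows "reduced_expr n (rev js) (Hilbert_Choice.inv w)"
proof -
  have "expr_for n (rev ks) w" if "expr_for n ks (Hilbert_Choice.inv w)" for ks
    using that assms
    by (auto simp: reduced_expr_def expr_for_def word_perm_rev inv_inv_eq bij_word_perm)
  then show ?thesis
    using assms unfolding reduced_expr_def
    by (metis expr_for_def length_rev set_rev word_perm_rev)
qed

text \<open>A subword is no longer than the word, which rules out a descent; conversely, prepending
  j to a reduced expression of w exhibits w as a subword. This turns the condition on paths in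
  \<open>C_set\<close> into an ascent condition.\<close>

lemma bruhat_less_adj_comp_iff:
  assumes w: "w permutes {1..n}" and j: "j \<in> {1..<n}"
  shows "bruhat_less n w (adj j \<circ> w) \<longleftrightarrow> asc j w"
proof
  assume "bruhat_less n w (adj j \<circ> w)"
  then obtain as bs where "reduced_expr n as w" "reduced_expr n bs (adj j \<circ> w)" "subseq as bs"
    by (auto simp: bruhat_less_def bruhat_le_def)
  then have "card (inversions n w) \<le> card (inversions n (adj j \<circ> w))"
    using list_emb_length by (fastforce simp: reduced_expr_iff)
  then show "asc j w"
    using card_inversions_desc[OF permutes_bij[OF w] j] by auto
next
  assume a: "asc j w"
  obtain js where js: "reduced_expr n js w" using reduced_expr_exists[OF w] by blast
  have "subseq js (j # js)" by auto
  then show "bruhat_less n w (adj j \<circ> w)"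
    using reduced_expr_Cons[OF w j a js] js adj_comp_neq[OF permutes_bij[OF w], of j]
    by (auto simp: bruhat_less_def bruhat_le_def)
qed

text \<open>The weak order provides one factorisation of u through t with additive lengths; this
  carries it over to the given \<open>js\<close>. The prefix \<open>as\<close> is an expression of
  the same element, so \<open>js\<close> is no longer than \<open>as\<close>, and u cannot have more
  inversions than \<open>js\<close> and t together allow.\<close>

lemma weak_le_card_inversions:
  assumes "weak_le n t u" and js: "reduced_expr n js (u \<circ> Hilbert_Choice.inv t)"
  shows "card (inversions n u) = length js + card (inversions n t)" "u = word_perm js \<circ> t"
proof -
  obtain as bs where ab: "reduced_expr n (as @ bs) u" "reduced_expr n bs t"
    using assms(1) by (auto simp: weak_le_def)
  have t: "bij t"
    using ab(2) by (auto simp: reduced_expr_iff expr_for_def bij_word_perm)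
  have u: "u = word_perm as \<circ> t"
    using ab by (auto simp: reduced_expr_iff expr_for_def word_perm_append)
  then have "u \<circ> Hilbert_Choice.inv t = word_perm as"
    using bij_is_surj[OF t] by (simp only: comp_assoc surj_iff comp_id)
  then have "expr_for n as (u \<circ> Hilbert_Choice.inv t)"
    using ab by (auto simp: reduced_expr_iff expr_for_def)
  then have "length js \<le> length as" using js by (auto simp: reduced_expr_def)
  moreover have "card (inversions n u) = length as + card (inversions n t)"
    using ab by (auto simp: reduced_expr_iff)
  moreover show "u = word_perm js \<circ> t"
    using js bij_is_inj[OF t] by (simp add: reduced_expr_iff expr_for_def)
  moreover have "card (inversions n (word_perm js \<circ> t)) \<le> length js + card (inversions n t)"
    using js by (intro card_inversions_word_perm_comp_le t) (auto simp: reduced_expr_iff expr_for_def)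
  ultimately show "card (inversions n u) = length js + card (inversions n t)"
    by simp
qed


section \<open>The regular representation of the Hecke algebra\<close>

definition q1 :: laurent where
  "q1 = qh - qh_inv"

definition T_basis :: "(nat \<Rightarrow> nat) \<Rightarrow> (nat \<Rightarrow> nat) \<Rightarrow> laurent" where
  "T_basis w = (\<lambda>x. if x = w then 1 else 0)"

text \<open>
  A function \<open>f\<close> stands for the element \<open>\<Sum>\<^sub>w f(w) T\<^sub>w\<close>, where \<open>T\<^sub>s\<^sup>2 = 1 + q\<^sub>1 T\<^sub>s\<close>; left and right
  multiplication by \<open>T\<^sub>s\<close> are written out on coefficients, so that no finiteness of support is
  needed.
\<close>

definition hecke_left ::
    "nat \<Rightarrow> ((nat \<Rightarrow> nat) \<Rightarrow> laurent) \<Rightarrow> (nat \<Rightarrow> nat) \<Rightarrow> laurent" where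
  "hecke_left j f = (\<lambda>x. if bij x then f (adj j \<circ> x) + (if asc j x then 0 else q1 * f x) else 0)"

definition hecke_right ::
    "nat \<Rightarrow> ((nat \<Rightarrow> nat) \<Rightarrow> laurent) \<Rightarrow> (nat \<Rightarrow> nat) \<Rightarrow> laurent" where
  "hecke_right j f =
     (\<lambda>x. if bij x then f (x \<circ> adj j) + (if x j < x (Suc j) then 0 else q1 * f x) else 0)"

definition hecke_left_word ::
    "nat list \<Rightarrow> ((nat \<Rightarrow> nat) \<Rightarrow> laurent) \<Rightarrow> (nat \<Rightarrow> nat) \<Rightarrow> laurent" where
  "hecke_left_word js = foldr hecke_left js"

definition hecke_right_word ::
    "nat list \<Rightarrow> ((nat \<Rightarrow> nat) \<Rightarrow> laurent) \<Rightarrow> (nat \<Rightarrow> nat) \<Rightarrow> laurent" where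
  "hecke_right_word js = foldr hecke_right js"

section \<open>Left and right multiplications commute\<close>

lemma one_line_app_eq_iff: "bij x \<Longrightarrow> one_line x i = k \<longleftrightarrow> x k = i"
  unfolding one_line_def by (metis bij_inv_eq_iff)

lemma adj_less_iff:
  assumes "a \<noteq> b" "{a, b} \<noteq> {i, Suc i}"
  shows "adj i a < adj i b \<longleftrightarrow> a < b"
  using assms by (auto simp: adj_def transpose_def doubleton_eq_iff)

text \<open>Conjugating the transposition s_j by x gives the transposition of x j and x
  (j+1).\<close>

lemma adj_comp_eq_comp_adj:
  assumes x: "bij x" and e: "{x j, x (Suc j)} = {i, Suc i}"
  shows "adj i \<circ> x = x \<circ> adj j"
proof
  fix a
  have inj: "x a = x b \<longleftrightarrow> a = b" for a b
    using x by (meson bij_is_inj inj_eq)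
  consider "a = j" | "a = Suc j" | "a \<noteq> j" "a \<noteq> Suc j" by blast
  then show "(adj i \<circ> x) a = (x \<circ> adj j) a"
  proof cases
    case 3
    then have "x a \<notin> {i, Suc i}" using inj by (auto simp: e[symmetric])
    then show ?thesis using 3 by (simp add: adj_other)
  qed (use e in \<open>auto simp: doubleton_eq_iff\<close>)
qed

text \<open>If x maps {j, j+1} onto {i, i+1}, then s_i x = x s_j and the left and right ascent
  conditions at x coincide. Otherwise multiplying on one side leaves the ascent condition on the
  other side unchanged. In both cases the coefficients at x agree.\<close>

lemma hecke_left_right_commute:
  "hecke_left i (hecke_right j f) = hecke_right j (hecke_left i f)"
proof
  fix x :: "nat \<Rightarrow> nat"
  show "hecke_left i (hecke_right j f) x = hecke_right j (hecke_left i f) x"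
  proof (cases "bij x")
    case x: True
    have b: "bij (adj i \<circ> x)" "bij (x \<circ> adj j)" "bij (adj i \<circ> x \<circ> adj j)"
      using x by (auto intro!: bij_comp)
    have inj: "x a = x b \<longleftrightarrow> a = b" for a b
      using x by (meson bij_is_inj inj_eq)
    let ?y = "one_line x"
    have y: "?y (x a) = a" for a
      using one_line_app_eq_iff[OF x] by blast
    have oy: "one_line (x \<circ> adj j) = adj j \<circ> ?y"
      unfolding one_line_def using o_inv_distrib[OF x bij_adj] by (simp only: inv_adj)
    have yinj: "?y a = ?y b \<longleftrightarrow> a = b" for a b
      using bij_one_line[OF x] by (meson bij_is_inj inj_eq)
    show ?thesis
    proof (cases "{x j, x (Suc j)} = {i, Suc i}")
      case True
      have c: "adj i \<circ> x = x \<circ> adj j" using adj_comp_eq_comp_adj[OF x True] .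
      have "asc i x \<longleftrightarrow> x j < x (Suc j)"
        using True y[of j] y[of "Suc j"] by (auto simp: asc_def doubleton_eq_iff)
      moreover have "asc i (x \<circ> adj j) \<longleftrightarrow> \<not> asc i x"
        using asc_adj_comp[OF x, of i] by (simp only: c)
      moreover have "(x \<circ> adj j) j < (x \<circ> adj j) (Suc j) \<longleftrightarrow> \<not> x j < x (Suc j)"
        using inj[of j "Suc j"] by auto
      ultimately show ?thesis
        using x b by (simp add: hecke_left_def hecke_right_def c[symmetric] algebra_simps comp_assoc)
    next
      case False
      have 1: "adj i (x j) < adj i (x (Suc j)) \<longleftrightarrow> x j < x (Suc j)"
        using False inj[of j "Suc j"] by (intro adj_less_iff) auto
      have "{?y i, ?y (Suc i)} \<noteq> {j, Suc j}"
        using False y yinj one_line_app_eq_iff[OF x] by (auto simp: doubleton_eq_iff)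
      then have 2: "asc i (x \<circ> adj j) \<longleftrightarrow> asc i x"
        unfolding asc_def oy comp_apply using yinj[of i "Suc i"] by (intro adj_less_iff) auto
      show ?thesis
        using x b 1 2 by (simp add: hecke_left_def hecke_right_def algebra_simps comp_assoc)
    qed
  qed (simp add: hecke_left_def hecke_right_def)
qed

lemma hecke_left_word_right_commute:
  "hecke_left_word js (hecke_right j f) = hecke_right j (hecke_left_word js f)"
  by (induction js) (simp_all add: hecke_left_word_def hecke_left_right_commute)

lemma hecke_left_right_word_commute:
  "hecke_left_word js (hecke_right_word ks f) = hecke_right_word ks (hecke_left_word js f)"
proof (induction ks)
  case (Cons k ks)
  then show ?case
    using hecke_left_word_right_commute[of js k]
    by (simp add: hecke_right_word_def)
qed (simp add: hecke_right_word_def)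

section \<open>Products of generators with basis elements\<close>

lemma hecke_left_T_basis_asc:
  "bij w \<Longrightarrow> asc j w \<Longrightarrow> hecke_left j (T_basis w) = T_basis (adj j \<circ> w)"
proof
  fix x assume w: "bij w" "asc j w"
  have "adj j \<circ> x = w \<longleftrightarrow> x = adj j \<circ> w"
    by (metis adj_comp_adj_comp(1))
  then show "hecke_left j (T_basis w) x = T_basis (adj j \<circ> w) x"
    using w adj_comp_bij[OF w(1), of j] by (auto simp: hecke_left_def T_basis_def)
qed

lemma hecke_left_T_basis_desc:
  "bij w \<Longrightarrow> \<not> asc j w \<Longrightarrow>
    hecke_left j (T_basis w) = (\<lambda>x. T_basis (adj j \<circ> w) x + q1 * T_basis w x)"
proof
  fix x assume w: "bij w" "\<not> asc j w"
  have "adj j \<circ> x = w \<longleftrightarrow> x = adj j \<circ> w"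
    by (metis adj_comp_adj_comp(1))
  then show "hecke_left j (T_basis w) x = T_basis (adj j \<circ> w) x + q1 * T_basis w x"
    using w adj_comp_bij[OF w(1), of j] by (auto simp: hecke_left_def T_basis_def)
qed

lemma hecke_right_T_basis_asc:
  assumes "bij w" "w j < w (Suc j)"
  shows "hecke_right j (T_basis w) = T_basis (w \<circ> adj j)"
proof
  fix x
  have "x \<circ> adj j = w \<longleftrightarrow> x = w \<circ> adj j"
    by (metis adj_comp_adj_comp(2))
  moreover have "bij (w \<circ> adj j)" using assms by (intro bij_comp) auto
  moreover have "w \<circ> adj j \<noteq> w"
    using assms(2) by (metis adj_values(1) comp_apply less_irrefl)
  ultimately show "hecke_right j (T_basis w) x = T_basis (w \<circ> adj j) x"
    using assms by (auto simp: hecke_right_def T_basis_def)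
qed

lemma hecke_left_word_T_id:
  "reduced_expr n js w \<Longrightarrow> hecke_left_word js (T_basis id) = T_basis w"
proof (induction js arbitrary: w)
  case Nil
  then show ?case by (simp add: hecke_left_word_def reduced_expr_iff expr_for_def)
next
  case (Cons j js)
  have w: "w = adj j \<circ> word_perm js"
    using Cons.prems by (simp add: reduced_expr_iff expr_for_def)
  show ?case
    using Cons.IH[OF reduced_expr_ConsD(1)[OF Cons.prems]]
      hecke_left_T_basis_asc[OF bij_word_perm reduced_expr_ConsD(2)[OF Cons.prems]] w
    by (simp add: hecke_left_word_def comp_def id_def)
qed

text \<open>The head of the list is multiplied on last, hence furthest to the right, so the letters
  occur in reverse order and the inverse appears.\<close>

lemma hecke_right_word_T_id:
  "reduced_expr n js w \<Longrightarrow> hecke_right_word js (T_basis id) = T_basis (Hilbert_Choice.inv w)"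
proof (induction js arbitrary: w)
  case Nil
  then show ?case by (simp add: hecke_right_word_def reduced_expr_iff expr_for_def)
next
  case (Cons j js)
  let ?v = "Hilbert_Choice.inv (word_perm js)"
  have w: "w = adj j \<circ> word_perm js"
    using Cons.prems by (simp add: reduced_expr_iff expr_for_def)
  have "Hilbert_Choice.inv w = ?v \<circ> adj j"
    unfolding w using o_inv_distrib[OF bij_adj bij_word_perm] by (simp only: inv_adj)
  moreover have "?v j < ?v (Suc j)"
    using reduced_expr_ConsD(2)[OF Cons.prems] by (simp add: asc_def one_line_def)
  ultimately show ?case
    using Cons.IH[OF reduced_expr_ConsD(1)[OF Cons.prems]]
      hecke_right_T_basis_asc[of ?v j] bij_imp_bij_inv[OF bij_word_perm, of js]
    by (simp add: hecke_right_word_def comp_def id_def)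
qed

text \<open>
  Commuting left multiplications past right ones replaces the braid relations: two reduced
  expressions of one element already agree on \<open>T\<^sub>1\<close>.
\<close>

lemma hecke_left_word_reduced_unique:
  assumes "reduced_expr n js x" "reduced_expr n ks x" "v permutes {1..n}"
  shows "hecke_left_word js (T_basis v) = hecke_left_word ks (T_basis v)"
proof -
  obtain cs where "reduced_expr n cs (Hilbert_Choice.inv v)"
    using reduced_expr_exists[OF permutes_inv[OF assms(3)]] by blast
  then have "T_basis v = hecke_right_word cs (T_basis id)"
    using hecke_right_word_T_id by (simp add: inv_inv_eq permutes_bij[OF assms(3)])
  then show ?thesis
    using assms(1,2) by (simp add: hecke_left_right_word_commute hecke_left_word_T_id)
qed

section \<open>Linearity and injectivity of left multiplication\<close>

lemma hecke_left_word_linear: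
  "hecke_left_word js (\<lambda>x. f x + c * g x) =
    (\<lambda>x. hecke_left_word js f x + c * hecke_left_word js g x)"
  by (induction js) (auto simp: hecke_left_word_def hecke_left_def fun_eq_iff algebra_simps)

lemma hecke_left_word_sum:
  assumes "finite A"
  shows "hecke_left_word js (\<lambda>x. \<Sum>a\<in>A. c a * f a x) =
    (\<lambda>x. \<Sum>a\<in>A. c a * hecke_left_word js (f a) x)"
  using assms
proof (induction A)
  case empty
  have "hecke_left_word js (\<lambda>x. 0) = (\<lambda>x. 0)"
    by (induction js) (auto simp: hecke_left_word_def hecke_left_def)
  then show ?case by simp
next
  case (insert a A)
  then show ?case
    using hecke_left_word_linear[of js "\<lambda>x. \<Sum>a\<in>A. c a * f a x" "c a" "f a"]
    by (simp add: add.commute)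
qed

text \<open>If y has a descent at j, the coefficient of the product at s_j y is just
  \<open>f y\<close>, so f vanishes at all descents. If x has an ascent, the coefficient at s_j x is
  \<open>f x\<close> plus a multiple of a value already known to vanish.\<close>

lemma hecke_left_eq_0D:
  assumes "\<And>x. bij x \<Longrightarrow> hecke_left j f x = 0" "bij x"
  shows "f x = 0"
proof -
  have desc: "f y = 0" if "bij y" "\<not> asc j y" for y
    using assms(1)[of "adj j \<circ> y"] that adj_comp_bij[OF that(1), of j]
      asc_adj_comp[OF that(1), of j]
    by (simp add: hecke_left_def)
  show ?thesis
    using assms(1)[of "adj j \<circ> x"] desc[of x] desc[of "adj j \<circ> x"] assms(2)
      adj_comp_bij[OF assms(2), of j] asc_adj_comp[OF assms(2), of j]
    by (auto simp: hecke_left_def)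
qed

lemma hecke_left_word_eq_0D:
  assumes "\<And>x. bij x \<Longrightarrow> hecke_left_word js f x = 0" "bij x"
  shows "f x = 0"
  using assms
proof (induction js arbitrary: x)
  case (Cons j js)
  have "hecke_left_word js f y = 0" if "bij y" for y
    using Cons.prems(1) that
    by (intro hecke_left_eq_0D[of j "hecke_left_word js f"]) (simp_all add: hecke_left_word_def)
  then show ?case using Cons by blast
qed (simp add: hecke_left_word_def)

text \<open>The coefficients of \<open>T\<^bsub>u\<inverse>\<^esub> T\<^sub>v\<close>, the image of \<open>x\<^sup>u\<^sup>,\<^sup>v\<close> in the Hecke algebra.\<close>

definition hecke_pair ::
    "nat \<Rightarrow> (nat \<Rightarrow> nat) \<Rightarrow> (nat \<Rightarrow> nat) \<Rightarrow> (nat \<Rightarrow> nat) \<Rightarrow> laurent" where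
  "hecke_pair n u v =
     hecke_left_word (SOME js. reduced_expr n js (Hilbert_Choice.inv u)) (T_basis v)"

lemma hecke_pair_eq:
  assumes "reduced_expr n js (Hilbert_Choice.inv u)" "v permutes {1..n}"
  shows "hecke_pair n u v = hecke_left_word js (T_basis v)"
  unfolding hecke_pair_def
  by (rule hecke_left_word_reduced_unique[OF someI[of "\<lambda>ks. reduced_expr n ks (Hilbert_Choice.inv u)", OF assms(1)] assms])

text \<open>Since s_j u > u, the inverse of s_j u has a reduced expression ending in j. The factor
  T_s thus stands next to T_v, where the quadratic relation expands T_s T_v.\<close>

lemma hecke_pair_adj_comp:
  assumes u: "u permutes {1..n}" and v: "v permutes {1..n}"
    and j: "j \<in> {1..<n}" "asc j u"
  shows "hecke_pair n (adj j \<circ> u) v =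
    (\<lambda>x. hecke_pair n u (adj j \<circ> v) x + (if asc j v then 0 else q1 * hecke_pair n u v x))"
proof -
  obtain js where js: "reduced_expr n js u" using reduced_expr_exists[OF u] by blast
  have 1: "reduced_expr n (rev js) (Hilbert_Choice.inv u)"
    by (rule reduced_expr_rev[OF js])
  have 2: "reduced_expr n (rev js @ [j]) (Hilbert_Choice.inv (adj j \<circ> u))"
    using reduced_expr_rev[OF reduced_expr_Cons[OF u j js]] by simp
  have sv: "adj j \<circ> v permutes {1..n}" by (rule adj_comp_permutes[OF j(1) v])
  have "hecke_pair n (adj j \<circ> u) v = hecke_left_word (rev js) (hecke_left j (T_basis v))"
    using hecke_pair_eq[OF 2 v] by (simp add: hecke_left_word_def)
  then show ?thesis
    using hecke_left_T_basis_asc[OF permutes_bij[OF v], of j]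
      hecke_left_T_basis_desc[OF permutes_bij[OF v], of j]
    by (auto simp: hecke_pair_eq[OF 1 v] hecke_pair_eq[OF 1 sv] hecke_left_word_linear)
qed

lemma hecke_pair_independent:
  assumes t: "t permutes {1..n}"
    and zero: "\<And>x. (\<Sum>w | w permutes {1..n}. d w * hecke_pair n t w x) = 0"
    and w: "w permutes {1..n}"
  shows "d w = 0"
proof -
  obtain js where js: "reduced_expr n js (Hilbert_Choice.inv t)"
    using reduced_expr_exists[OF permutes_inv[OF t]] by blast
  have fin: "finite {w. w permutes {1..n}}" by (simp add: finite_permutations)
  \<comment> \<open>The common left factor belonging to the inverse of t is pulled out of the sum,
    so that it can be cancelled by injectivity.\<close>
  have "hecke_left_word js (\<lambda>x. \<Sum>w | w permutes {1..n}. d w * T_basis w x) x = 0" for x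
    using zero[of x] unfolding hecke_left_word_sum[OF fin] by (simp add: hecke_pair_eq[OF js])
  then have "(\<Sum>w' | w' permutes {1..n}. d w' * T_basis w' w) = 0"
    by (rule hecke_left_word_eq_0D[OF _ permutes_bij[OF w]])
  also have "(\<Sum>w' | w' permutes {1..n}. d w' * T_basis w' w) =
      (\<Sum>w' | w' permutes {1..n}. if w' = w then d w' else 0)"
    by (intro sum.cong) (auto simp: T_basis_def)
  also have "\<dots> = d w" using fin w by simp
  finally show ?thesis by simp
qed


section \<open>Linear functionals on the quantum matrix bialgebra\<close>

lemma poly_mapping_add_induct [case_names single add]:
  fixes f :: "'a \<Rightarrow>\<^sub>0 'b::comm_monoid_add"
  assumes single: "\<And>m c. P (Poly_Mapping.single m c)"
    and add: "\<And>f g. P f \<Longrightarrow> P g \<Longrightarrow> P (f + g)"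
  shows "P f"
proof -
  let ?g = "\<lambda>A. \<Sum>m\<in>A. Poly_Mapping.single m (Poly_Mapping.lookup f m)"
  have "P (?g A)" if "finite A" for A
    using that
  proof (induction A)
    case empty
    \<comment> \<open>The zero mapping is a single term with coefficient 0, at whatever key.\<close>
    then show ?case using single[of undefined 0] by simp
  qed (simp add: single add)
  moreover have "f = ?g (Poly_Mapping.keys f)"
  proof (rule poly_mapping_eqI)
    fix k
    have "Poly_Mapping.lookup (?g (Poly_Mapping.keys f)) k =
        (\<Sum>m\<in>Poly_Mapping.keys f. if m = k then Poly_Mapping.lookup f m else 0)"
      unfolding lookup_sum by (intro sum.cong) (auto simp: lookup_single when_def)
    then show "Poly_Mapping.lookup f k = Poly_Mapping.lookup (?g (Poly_Mapping.keys f)) k"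
      by (simp add: in_keys_iff)
  qed
  ultimately show ?thesis by (metis finite_keys)
qed

definition lin_ext :: "('a \<Rightarrow> 'b::comm_ring_1) \<Rightarrow> ('a \<Rightarrow>\<^sub>0 'b) \<Rightarrow> 'b" where
  "lin_ext \<phi> f = (\<Sum>m\<in>Poly_Mapping.keys f. Poly_Mapping.lookup f m * \<phi> m)"

lemma lin_ext_0 [simp]: "lin_ext \<phi> 0 = 0"
  by (simp add: lin_ext_def)

lemma lin_ext_single [simp]: "lin_ext \<phi> (Poly_Mapping.single m c) = c * \<phi> m"
  by (simp add: lin_ext_def)

lemma lin_ext_add: "lin_ext \<phi> (f + g) = lin_ext \<phi> f + lin_ext \<phi> g"
  unfolding lin_ext_def
  by (rule setsum_keys_plus_distrib) (simp_all add: distrib_right)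

lemma lin_ext_diff: "lin_ext \<phi> (f - g) = lin_ext \<phi> f - lin_ext \<phi> g"
  using lin_ext_add[of \<phi> "f - g" g] by (simp add: algebra_simps)

lemma lin_ext_sum: "lin_ext \<phi> (\<Sum>a\<in>A. f a) = (\<Sum>a\<in>A. lin_ext \<phi> (f a))"
  by (induction A rule: infinite_finite_induct) (simp_all add: lin_ext_add)

text \<open>The value is additive in a and in b separately, so monomial multipliers suffice.\<close>

lemma lin_ext_mult_eq_0I:
  fixes f :: "'a::monoid_add \<Rightarrow>\<^sub>0 'b::comm_ring_1"
  assumes "\<And>m m' c c'.
    lin_ext \<phi> (Poly_Mapping.single m c * f * Poly_Mapping.single m' c') = 0"
  shows "lin_ext \<phi> (a * f * b) = 0"
proof (induction a rule: poly_mapping_add_induct)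
  case (single m c)
  show ?case
    by (induction b rule: poly_mapping_add_induct)
      (simp_all add: assms distrib_left lin_ext_add)
qed (simp add: distrib_right lin_ext_add)

section \<open>Monomials indexed by two permutations, and a functional compatible with the
  relations\<close>

definition row_col :: "(nat \<Rightarrow> nat) \<Rightarrow> (nat \<Rightarrow> nat) \<Rightarrow> nat list \<Rightarrow> (nat \<times> nat) list" where
  "row_col u v is = map (\<lambda>i. (one_line u i, one_line v i)) is"

definition xword :: "nat \<Rightarrow> (nat \<Rightarrow> nat) \<Rightarrow> (nat \<Rightarrow> nat) \<Rightarrow> (nat \<times> nat) fmonoid" where
  "xword n u v = Word (row_col u v [1..<Suc n])"

lemma row_col_adj:
  assumes "bij u" "bij v" "p \<notin> set is" "Suc p \<notin> set is"
  shows "row_col (adj p \<circ> u) v is = row_col u v is" "row_col u (adj p \<circ> v) is = row_col u v is"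
proof -
  have "adj p i = i" if "i \<in> set is" for i
    using that assms(3,4) by (metis adj_other)
  then show "row_col (adj p \<circ> u) v is = row_col u v is" "row_col u (adj p \<circ> v) is = row_col u v is"
    using assms(1,2) by (simp_all add: row_col_def one_line_adj_comp)
qed

lemma upt_split: "p \<in> {1..<n} \<Longrightarrow> [1..<Suc n] = [1..<p] @ [p, Suc p] @ [Suc (Suc p)..<Suc n]"
proof -
  assume p: "p \<in> {1..<n}"
  have "[1..<Suc n] = [1..<p] @ [p..<Suc n]" using p upt_add_eq_append[of 1 p "Suc n - p"] by (simp del: upt_Suc)
  also have "[p..<Suc n] = p # Suc p # [Suc (Suc p)..<Suc n]"
    using p by (simp add: upt_conv_Cons)
  finally show ?thesis by simp
qed

lemma xword_split:
  assumes "p \<in> {1..<n}"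
  shows "xword n u v = Word (row_col u v [1..<p] @
    [(one_line u p, one_line v p), (one_line u (Suc p), one_line v (Suc p))] @
    row_col u v [Suc (Suc p)..<Suc n])"
  unfolding xword_def upt_split[OF assms] by (simp add: row_col_def)

text \<open>The dictionary between relations and permutations: exchanging two neighbouring row
  indices acts on u, exchanging the column indices acts on v. Positions count from 1, hence the
  successor in p.\<close>

lemma xword_eq_appendD:
  assumes e: "Word (m1 @ [(a, c), (b, d)] @ m2) = xword n u v"
    and u: "u permutes {1..n}" and v: "v permutes {1..n}" and p: "p = Suc (length m1)"
  shows "p \<in> {1..<n}"
    "one_line u p = a" "one_line u (Suc p) = b" "one_line v p = c" "one_line v (Suc p) = d"
    "Word (m1 @ [(b, c), (a, d)] @ m2) = xword n (adj p \<circ> u) v"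
    "Word (m1 @ [(a, d), (b, c)] @ m2) = xword n u (adj p \<circ> v)"
proof -
  note bu = permutes_bij[OF u] and bv = permutes_bij[OF v]
  have "length (m1 @ [(a, c), (b, d)] @ m2) = n"
    using e by (simp add: xword_def row_col_def)
  then show P: "p \<in> {1..<n}" using p by auto
  have "length m1 = length (row_col u v [1..<p])" by (simp add: row_col_def p del: upt_Suc)
  then have m: "m1 = row_col u v [1..<p]" "m2 = row_col u v [Suc (Suc p)..<Suc n]"
    and ol: "one_line u p = a" "one_line u (Suc p) = b" "one_line v p = c" "one_line v (Suc p) = d"
    using e unfolding xword_split[OF P] by (auto simp del: upt_Suc)
  show "Word (m1 @ [(b, c), (a, d)] @ m2) = xword n (adj p \<circ> u) v"
    "Word (m1 @ [(a, d), (b, c)] @ m2) = xword n u (adj p \<circ> v)"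
    unfolding xword_split[OF P] m
    by (simp_all add: row_col_adj[OF bu bv] one_line_adj_comp[OF bu] one_line_adj_comp[OF bv] ol
        del: upt_Suc)
  show "one_line u p = a" "one_line u (Suc p) = b" "one_line v p = c" "one_line v (Suc p) = d"
    by (fact ol)+
qed

lemma permutes_one_line_cong:
  assumes u: "u permutes {1..n}" and u': "u' permutes {1..n}"
    and e: "\<And>i. i \<in> {1..n} \<Longrightarrow> one_line u i = one_line u' i"
  shows "u = u'"
proof -
  have "one_line u = one_line u'"
  proof
    fix i
    show "one_line u i = one_line u' i"
      using e permutes_not_in[OF permutes_inv[OF u], of i] permutes_not_in[OF permutes_inv[OF u'], of i]
      by (cases "i \<in> {1..n}") (auto simp: one_line_def)
  qed
  then show ?thesis
    by (metis inv_inv_eq one_line_def permutes_bij[OF u] permutes_bij[OF u'])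
qed

lemma xword_inject:
  assumes "u permutes {1..n}" "v permutes {1..n}" "u' permutes {1..n}" "v' permutes {1..n}"
    and "xword n u v = xword n u' v'"
  shows "u = u' \<and> v = v'"
proof -
  have "\<forall>i \<in> set [1..<Suc n]. (one_line u i, one_line v i) = (one_line u' i, one_line v' i)"
    using assms(5) unfolding xword_def row_col_def by (simp only: fmonoid.inject map_eq_conv)
  then have "one_line u i = one_line u' i" "one_line v i = one_line v' i" if "i \<in> {1..n}" for i
    using that by (auto simp del: upt_Suc)
  then show ?thesis using assms(1-4) permutes_one_line_cong by blast
qed

text \<open>As \<open>xword\<close> is injective on pairs of permutations, the sum has at most one
  term. Writing it as a sum gives the value 0 at all words outside the multidegree.\<close>

definition xword_coeff :: "nat \<Rightarrow> (nat \<Rightarrow> nat) \<Rightarrow> (nat \<times> nat) fmonoid \<Rightarrow> laurent" where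
  "xword_coeff n x m =
     (\<Sum>(u, v) | u permutes {1..n} \<and> v permutes {1..n} \<and> m = xword n u v. hecke_pair n u v x)"

lemma xword_coeff_xword:
  assumes "u permutes {1..n}" "v permutes {1..n}"
  shows "xword_coeff n x (xword n u v) = hecke_pair n u v x"
proof -
  have "{(u', v'). u' permutes {1..n} \<and> v' permutes {1..n} \<and> xword n u v = xword n u' v'} = {(u, v)}"
    using assms xword_inject[OF assms] by blast
  then show ?thesis unfolding xword_coeff_def by simp
qed

lemma xword_coeff_eq_0:
  assumes "\<And>u v. u permutes {1..n} \<Longrightarrow> v permutes {1..n} \<Longrightarrow> m \<noteq> xword n u v"
  shows "xword_coeff n x m = 0"
proof -
  have "{(u, v). u permutes {1..n} \<and> v permutes {1..n} \<and> m = xword n u v} = {}"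
    using assms by blast
  then show ?thesis unfolding xword_coeff_def by (simp only: sum.empty)
qed

text \<open>Rows and columns of the monomials in question are all distinct. Both sides of the
  q-commutation relations within a row or a column are therefore sent to 0.\<close>

lemma xword_coeff_repeated:
  assumes "a = b \<or> c = d"
  shows "xword_coeff n x (Word (m1 @ [(a, c), (b, d)] @ m2)) = 0"
proof (rule xword_coeff_eq_0, rule notI)
  fix u v assume uv: "u permutes {1..n}" "v permutes {1..n}"
    and e: "Word (m1 @ [(a, c), (b, d)] @ m2) = xword n u v"
  have "one_line u i = one_line u k \<longleftrightarrow> i = k" "one_line v i = one_line v k \<longleftrightarrow> i = k" for i k
    using uv by (meson bij_is_inj bij_one_line inj_eq permutes_bij)+
  then show False
    using xword_eq_appendD(2-5)[OF e uv refl] assms by (metis n_not_Suc_n)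
qed

text \<open>When the words come from permutations, the four of them belong to (u, v), (su, v), (u,
  sv) and (su, sv) with s u > u and s v > v. The two relations are then
  \<open>hecke_pair_adj_comp\<close> at v and at s v.\<close>

lemma xword_coeff_relations:
  fixes m1 m2 :: "(nat \<times> nat) list" and n :: nat and x :: "nat \<Rightarrow> nat"
  assumes ij: "i < j" and kl: "k < l"
  defines "\<phi> \<equiv> \<lambda>a b. xword_coeff n x (Word (m1 @ [a, b] @ m2))"
  shows "\<phi> (j, k) (i, l) = \<phi> (i, l) (j, k)"
    and "\<phi> (j, l) (i, k) = \<phi> (i, k) (j, l) + q1 * \<phi> (i, l) (j, k)"
proof -
  define p where "p = Suc (length m1)"
  let ?X = "\<lambda>a b. \<exists>u v. u permutes {1..n} \<and> v permutes {1..n} \<and>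
    Word (m1 @ [a, b] @ m2) = xword n u v"
  have "\<phi> (j, k) (i, l) = \<phi> (i, l) (j, k) \<and>
    \<phi> (j, l) (i, k) = \<phi> (i, k) (j, l) + q1 * \<phi> (i, l) (j, k)"
  proof (cases "?X (i, k) (j, l)")
    case True
    then obtain u v where u: "u permutes {1..n}" and v: "v permutes {1..n}"
      and e: "Word (m1 @ [(i, k), (j, l)] @ m2) = xword n u v"
      by blast
    note D = xword_eq_appendD[OF e u v p_def]
    have su: "adj p \<circ> u permutes {1..n}" and sv: "adj p \<circ> v permutes {1..n}"
      by (intro adj_comp_permutes D(1) u v)+
    have au: "asc p u" and av: "asc p v" using D(2-5) ij kl by (simp_all add: asc_def)
    have nav: "\<not> asc p (adj p \<circ> v)" using av asc_adj_comp[OF permutes_bij[OF v]] by simp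
    have e4: "Word (m1 @ [(j, l), (i, k)] @ m2) = xword n (adj p \<circ> u) (adj p \<circ> v)"
      using xword_eq_appendD(6)[OF D(7) u sv p_def] .
    show ?thesis
      unfolding \<phi>_def e D(6) D(7) e4
      using hecke_pair_adj_comp[OF u v D(1) au] hecke_pair_adj_comp[OF u sv D(1) au] av nav
      by (simp add: xword_coeff_xword u v su sv del: One_nat_def)
  next
    case False
    \<comment> \<open>Row and column exchanges connect the four words, so if one of them is outside
      the multidegree, all are.\<close>
    have rows: "?X (b, c) (a, d)" if "?X (a, c) (b, d)" for a b c d
    proof -
      obtain u v where uv: "u permutes {1..n}" "v permutes {1..n}"
        and e: "Word (m1 @ [(a, c), (b, d)] @ m2) = xword n u v" using \<open>?X (a, c) (b, d)\<close> by blast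
      note D = xword_eq_appendD[OF e uv p_def]
      show ?thesis using uv D(6) adj_comp_permutes[OF D(1) uv(1)] by blast
    qed
    have cols: "?X (a, d) (b, c)" if "?X (a, c) (b, d)" for a b c d
    proof -
      obtain u v where uv: "u permutes {1..n}" "v permutes {1..n}"
        and e: "Word (m1 @ [(a, c), (b, d)] @ m2) = xword n u v" using \<open>?X (a, c) (b, d)\<close> by blast
      note D = xword_eq_appendD[OF e uv p_def]
      show ?thesis using uv D(7) adj_comp_permutes[OF D(1) uv(2)] by blast
    qed
    have "\<not> ?X (j, k) (i, l)" "\<not> ?X (i, l) (j, k)" "\<not> ?X (j, l) (i, k)"
      using False rows cols by blast+
    then have "\<phi> (j, k) (i, l) = 0" "\<phi> (i, l) (j, k) = 0" "\<phi> (j, l) (i, k) = 0" "\<phi> (i, k) (j, l) = 0"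
      unfolding \<phi>_def using False by (blast intro: xword_coeff_eq_0)+
    then show ?thesis by simp
  qed
  then show "\<phi> (j, k) (i, l) = \<phi> (i, l) (j, k)"
    and "\<phi> (j, l) (i, k) = \<phi> (i, k) (j, l) + q1 * \<phi> (i, l) (j, k)" by blast+
qed

lemma Word_plus [simp]: "Word a + Word b = Word (a @ b)"
  by (simp add: plus_fmonoid_def)

lemma lin_ext_relator_eq_0:
  assumes "f \<in> qmat_relators n"
  shows "lin_ext (xword_coeff n x) (a * f * b) = 0"
proof (rule lin_ext_mult_eq_0I)
  fix m m' :: "(nat \<times> nat) fmonoid" and c c' :: laurent
  obtain m1 m2 where m: "m = Word m1" "m' = Word m2" by (metis fmonoid.exhaust)
  let ?S = "\<lambda>f. lin_ext (xword_coeff n x) (Poly_Mapping.single m c * f * Poly_Mapping.single m' c')"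
  have S2: "?S (gen a b * gen a' b') =
      c * c' * xword_coeff n x (Word (m1 @ [(a, b), (a', b')] @ m2))"
    and S3: "?S (const e * gen a b * gen a' b') =
      e * (c * c' * xword_coeff n x (Word (m1 @ [(a, b), (a', b')] @ m2)))" for a b a' b' e
    by (simp_all add: gen_def const_def mult_single m mult_ac)
  have lin: "?S (f - g) = ?S f - ?S g" "?S (f + g) = ?S f + ?S g" for f g
    by (simp_all add: algebra_simps lin_ext_add lin_ext_diff)
  show "?S f = 0"
    using assms unfolding qmat_relators_def q1_def[symmetric]
  proof (elim UnE CollectE exE conjE)
    fix i k l assume "f = gen i l * gen i k - const qh * gen i k * gen i l"
    then show ?thesis by (simp only: lin S2 S3 xword_coeff_repeated simp_thms) simp
  next
    fix i j k l assume f: "f = gen j k * gen i l - gen i l * gen j k" and "i < j" "k < l"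
    then show ?thesis by (simp only: lin S2 f xword_coeff_relations(1)) simp
  next
    fix i j k assume "f = gen j k * gen i k - const qh * gen i k * gen j k"
    then show ?thesis by (simp only: lin S2 S3 xword_coeff_repeated simp_thms) simp
  next
    fix i j k l
    assume f: "f = gen j l * gen i k - (gen i k * gen j l + const q1 * gen i l * gen j k)"
      and "i < j" "k < l"
    then show ?thesis
      by (simp only: lin S2 S3 f xword_coeff_relations(2)) (simp add: algebra_simps)
  qed
qed

section \<open>The free algebra and its ideal of relations\<close>

lemma free_ring_simps [simp]:
  "mult (free_ring n) = (*)" "one (free_ring n) = 1" "zero (free_ring n) = 0"
  "add (free_ring n) = (+)"
  by (simp_all add: free_ring_def)

lemma single_in_free_ring:
  "set m \<subseteq> {1..n} \<times> {1..n} \<Longrightarrow> Poly_Mapping.single (Word m) c \<in> carrier (free_ring n)"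
  by (auto simp: free_ring_def)

lemma gen_in_free_ring: "i \<in> {1..n} \<Longrightarrow> j \<in> {1..n} \<Longrightarrow> gen i j \<in> carrier (free_ring n)"
  unfolding gen_def by (rule single_in_free_ring) auto

lemma const_in_free_ring: "const c \<in> carrier (free_ring n)"
  unfolding const_def by (rule single_in_free_ring) auto

lemma free_ring_closed:
  assumes "f \<in> carrier (free_ring n)" "g \<in> carrier (free_ring n)"
  shows "f + g \<in> carrier (free_ring n)" "f * g \<in> carrier (free_ring n)"
    "- f \<in> carrier (free_ring n)" "f - g \<in> carrier (free_ring n)"
proof -
  interpret ring "free_ring n" by (rule ring_free_ring)
  show "f + g \<in> carrier (free_ring n)" "f * g \<in> carrier (free_ring n)"
    using add.m_closed[OF assms] m_closed[OF assms] by simp_all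
  show "- f \<in> carrier (free_ring n)" "f - g \<in> carrier (free_ring n)"
    using assms keys_diff[of f g] by (fastforce simp: free_ring_def)+
qed

lemma a_inv_free_ring: "f \<in> carrier (free_ring n) \<Longrightarrow> \<ominus>\<^bsub>free_ring n\<^esub> f = - f"
  using ring_free_ring[of n] free_ring_closed(3)[of f n f]
  by (intro abelian_group.minus_equality[OF ring.is_abelian_group]) auto

lemma a_minus_free_ring:
  "f \<in> carrier (free_ring n) \<Longrightarrow> g \<in> carrier (free_ring n) \<Longrightarrow> f \<ominus>\<^bsub>free_ring n\<^esub> g = f - g"
  by (simp add: a_minus_def a_inv_free_ring)

lemma qmat_relators_subset: "qmat_relators n \<subseteq> carrier (free_ring n)"
  unfolding qmat_relators_def
  by (auto intro!: free_ring_closed gen_in_free_ring const_in_free_ring simp del: atLeastAtMost_iff)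

lemma ideal_qmat_ideal: "ideal (qmat_ideal n) (free_ring n)"
  unfolding qmat_ideal_def
  by (rule ring.genideal_ideal[OF ring_free_ring qmat_relators_subset])

lemma relator_in_qmat_ideal: "f \<in> qmat_relators n \<Longrightarrow> f \<in> qmat_ideal n"
  unfolding qmat_ideal_def
  using ring.genideal_self[OF ring_free_ring qmat_relators_subset] by blast

lemma lin_ext_qmat_ideal_eq_0:
  assumes "f \<in> qmat_ideal n"
  shows "lin_ext (xword_coeff n x) f = 0"
proof -
  let ?L = "lin_ext (xword_coeff n x)"
  \<comment> \<open>Quantifying over multipliers on both sides builds ideal closure into the set; a
    = b = 1 recovers the claim.\<close>
  let ?K = "{f \<in> carrier (free_ring n). \<forall>a b. ?L (a * f * b) = 0}"
  interpret ring "free_ring n" by (rule ring_free_ring)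
  have "ideal ?K (free_ring n)"
  proof (rule idealI[OF ring_free_ring])
    show "subgroup ?K (add_monoid (free_ring n))"
    proof (rule add.subgroupI)
      show "?K \<noteq> {}" using zero_closed by force
    next
      fix f assume f: "f \<in> ?K"
      then show "\<ominus>\<^bsub>free_ring n\<^esub> f \<in> ?K"
        using free_ring_closed(3)[of f n f] lin_ext_diff[of "xword_coeff n x" 0]
        by (auto simp: a_inv_free_ring)
    next
      fix f g assume "f \<in> ?K" "g \<in> ?K"
      then show "f \<oplus>\<^bsub>free_ring n\<^esub> g \<in> ?K"
        using free_ring_closed(1)[of f n g] by (auto simp: algebra_simps lin_ext_add)
    qed auto
  next
    fix f g assume f: "f \<in> ?K" and g: "g \<in> carrier (free_ring n)"
    have "?L (a * (g * f) * b) = 0" "?L (a * (f * g) * b) = 0" for a b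
      using f by (simp_all add: mult.assoc[symmetric], simp add: mult.assoc)
    then show "g \<otimes>\<^bsub>free_ring n\<^esub> f \<in> ?K" "f \<otimes>\<^bsub>free_ring n\<^esub> g \<in> ?K"
      using f g free_ring_closed(2)[of f n g] free_ring_closed(2)[of g n f] by auto
  qed
  moreover have "qmat_relators n \<subseteq> ?K"
    using qmat_relators_subset lin_ext_relator_eq_0 by blast
  ultimately have "f \<in> ?K"
    using genideal_minimal assms unfolding qmat_ideal_def by blast
  then have "?L (1 * f * 1) = 0" by blast
  then show ?thesis by simp
qed


section \<open>Evaluation at \<open>q\<^sup>1\<^sup>/\<^sup>2 - q\<^sup>-\<^sup>1\<^sup>/\<^sup>2\<close>\<close>

lemma lookup_single_mult:
  fixes f :: "int \<Rightarrow>\<^sub>0 int"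
  shows "Poly_Mapping.lookup (Poly_Mapping.single a c * f) k = c * Poly_Mapping.lookup f (k - a)"
proof (induction f rule: poly_mapping_add_induct)
  case (single m d)
  then show ?case by (auto simp: mult_single lookup_single when_def)
qed (simp add: distrib_left lookup_add)

text \<open>A factor \<open>q1\<close> replaces the coefficient at m by the difference of those at
  m-1 and m+1; in the range considered, the one at m+1 lies beyond the top degree and
  vanishes.\<close>

lemma lookup_q1_power:
  "int k \<le> m \<Longrightarrow> Poly_Mapping.lookup (q1 ^ k) m = (if m = int k then 1 else 0)"
proof (induction k arbitrary: m)
  case 0
  then show ?case by (simp add: lookup_one when_def)
next
  case (Suc k)
  have "Poly_Mapping.lookup (q1 ^ Suc k) m =
      Poly_Mapping.lookup (q1 ^ k) (m - 1) - Poly_Mapping.lookup (q1 ^ k) (m + 1)"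
    by (simp add: q1_def qh_def qh_inv_def left_diff_distrib lookup_minus lookup_single_mult)
  then show ?case using Suc by auto
qed

lemma eval_q1_add: "eval_q1 (f + g) = eval_q1 f + eval_q1 g"
proof -
  have "map_poly of_nat (f + g) = map_poly of_nat f + (map_poly of_nat g :: laurent poly)"
    by (rule poly_eqI) (simp add: coeff_map_poly)
  then show ?thesis by (simp add: eval_q1_def)
qed

lemma eval_q1_pCons: "eval_q1 (pCons c f) = of_nat c + q1 * eval_q1 f"
proof -
  have "map_poly of_nat (pCons c f) = pCons (of_nat c) (map_poly of_nat f :: laurent poly)"
    by (rule poly_eqI) (simp add: coeff_map_poly coeff_pCons split: nat.split)
  then show ?thesis by (simp add: eval_q1_def q1_def)
qed

lemma eval_q1_0 [simp]: "eval_q1 0 = 0"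
  by (simp add: eval_q1_def)

lemma eval_q1_1 [simp]: "eval_q1 1 = 1"
  using eval_q1_pCons[of 1 0] by (simp add: one_pCons)

text \<open>A free bound N lets two polynomials of different degrees be compared over one index
  range.\<close>

lemma eval_q1_altdef:
  "degree f \<le> N \<Longrightarrow> eval_q1 f = (\<Sum>i\<le>N. of_nat (coeff f i) * q1 ^ i)"
proof (induction f arbitrary: N)
  case (pCons c f)
  show ?case
  proof (cases N)
    case 0
    then have "f = 0" using pCons by (auto split: if_splits)
    then show ?thesis using 0 by (simp add: eval_q1_pCons)
  next
    case (Suc M)
    then have "degree f \<le> M" using pCons by (auto split: if_splits)
    then show ?thesis
      using pCons.IH[of M] Suc
      by (simp add: eval_q1_pCons sum.atMost_Suc_shift sum_distrib_left mult_ac del: sum.atMost_Suc)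
  qed
qed simp

text \<open>\<open>q\<^sub>1\<^sup>d\<close> has top term \<open>q\<^sup>d\<^sup>/\<^sup>2\<close>, so the highest coefficient in which two polynomials differ is seen
  by the coefficient of \<open>q\<^sup>d\<^sup>/\<^sup>2\<close>.\<close>

lemma eval_q1_inject:
  assumes "eval_q1 f = eval_q1 g"
  shows "f = g"
proof (rule ccontr)
  assume ne: "f \<noteq> g"
  define N where "N = max (degree f) (degree g)"
  define D where "D = {i. coeff f i \<noteq> coeff g i}"
  have DN: "D \<subseteq> {..N}"
  proof
    fix i assume "i \<in> D"
    then have "\<not> (degree f < i \<and> degree g < i)" by (auto simp: D_def coeff_eq_0)
    then show "i \<in> {..N}" by (auto simp: N_def)
  qed
  then have fin: "finite D" by (rule finite_subset) simp
  have "D \<noteq> {}" using ne by (auto simp: D_def poly_eq_iff)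
  define d where "d = Max D"
  have d: "d \<in> D" unfolding d_def using fin \<open>D \<noteq> {}\<close> by (rule Max_in)
  have above: "coeff f i = coeff g i" if "d < i" for i
    using Max_ge[OF fin, of i] that by (auto simp: d_def D_def)
  have lk: "Poly_Mapping.lookup (eval_q1 h) (int d) =
      (\<Sum>i\<le>N. int (coeff h i) * Poly_Mapping.lookup (q1 ^ i) (int d))" if "degree h \<le> N" for h
  proof -
    have "Poly_Mapping.lookup (of_nat c * p) k = int c * Poly_Mapping.lookup p k" for c k and p :: laurent
      using lookup_single_mult[of 0 "int c" p k] by (simp flip: single_of_nat)
    then show ?thesis by (simp add: eval_q1_altdef[OF that] lookup_sum)
  qed
  have "0 = Poly_Mapping.lookup (eval_q1 f) (int d) - Poly_Mapping.lookup (eval_q1 g) (int d)"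
    using assms by simp
  also have "\<dots> = (\<Sum>i\<le>N. (int (coeff f i) - int (coeff g i)) * Poly_Mapping.lookup (q1 ^ i) (int d))"
    by (simp add: lk N_def left_diff_distrib sum_subtractf)
  also have "\<dots> = (\<Sum>i\<le>N. if i = d then int (coeff f d) - int (coeff g d) else 0)"
  proof (intro sum.cong refl)
    fix i
    show "(int (coeff f i) - int (coeff g i)) * Poly_Mapping.lookup (q1 ^ i) (int d) =
        (if i = d then int (coeff f d) - int (coeff g d) else 0)"
      using above[of i] lookup_q1_power[of i "int d"] by (cases i d rule: linorder_cases) auto
  qed
  also have "\<dots> = int (coeff f d) - int (coeff g d)" using d DN by auto
  finally show False using d by (auto simp: D_def)
qed


section \<open>The recursion for the path polynomials\<close>

lemma C_set_Nil: "C_set n b v w [] = (if b = 0 \<and> v = w then {[v]} else {})"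
  by (auto simp: C_set_def length_Suc_conv)

text \<open>Paths are split by their first step. Moving continues from s_j v with the same number of
  stays; staying is barred at an ascent and uses up one stay, which is impossible for b = 0.\<close>

lemma C_set_Cons:
  assumes "bij v"
  shows "C_set n b v w (j # js) = (#) v `
    (C_set n b (adj j \<circ> v) w js \<union>
     (if bruhat_less n v (adj j \<circ> v) then {} else {\<rho>. \<exists>b'. b = Suc b' \<and> \<rho> \<in> C_set n b' v w js}))"
    (is "?L = (#) v ` ?R")
proof (rule Set.set_eqI)
  fix \<pi> :: "(nat \<Rightarrow> nat) list"
  note ne = adj_comp_neq[OF assms, of j]
  have all_Suc: "(\<forall>i < Suc N. P i) \<longleftrightarrow> P 0 \<and> (\<forall>i < N. P (Suc i))" for N P
    using less_Suc_eq_0_disj by auto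
  show "\<pi> \<in> ?L \<longleftrightarrow> \<pi> \<in> (#) v ` ?R"
  proof (cases "\<exists>\<rho>. \<pi> = v # \<rho>")
    case True
    then obtain \<rho> where \<pi>: "\<pi> = v # \<rho>" by blast
    \<comment> \<open>Index 0 is the step from v into \<rho>; the remaining indices are those of
      \<rho> shifted by one.\<close>
    have stay: "card {i. i < Suc N \<and> \<rho> ! i = (v # \<rho>) ! i} =
        (if \<rho> ! 0 = v then 1 else 0) + card {i. i < N \<and> \<rho> ! Suc i = \<rho> ! i}" for N
    proof -
      have "{i. i < Suc N \<and> \<rho> ! i = (v # \<rho>) ! i} =
          (if \<rho> ! 0 = v then {0} else {}) \<union> Suc ` {i. i < N \<and> \<rho> ! Suc i = \<rho> ! i}"
        by (auto simp: less_Suc_eq_0_disj)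
      then show ?thesis
        by (auto simp: card_image card_insert_if)
    qed
    have "\<pi> \<in> ?L \<longleftrightarrow> \<rho> \<in> ?R"
      unfolding C_set_def \<pi> using ne
      by (auto simp: all_Suc stay)
    then show ?thesis using \<pi> by blast
  next
    case False
    then have "\<pi> \<notin> ?L"
      by (cases \<pi>) (auto simp: C_set_def)
    then show ?thesis using False by blast
  qed
qed

lemma finite_C_set: "bij v \<Longrightarrow> finite (C_set n b v w js)"
proof (induction js arbitrary: b v)
  case (Cons j js)
  have "{\<rho>. \<exists>b'. b = Suc b' \<and> \<rho> \<in> C_set n b' v w js} \<subseteq> C_set n (b - 1) v w js" by auto
  then have "finite {\<rho>. \<exists>b'. b = Suc b' \<and> \<rho> \<in> C_set n b' v w js}"
    using Cons by (meson finite_subset)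
  moreover have "finite (C_set n b (adj j \<circ> v) w js)"
    by (intro Cons.IH adj_comp_bij Cons.prems)
  ultimately show ?case unfolding C_set_Cons[OF Cons.prems] by auto
qed (simp add: C_set_Nil)

lemma coeff_p_poly: "coeff (p_poly n v w js) b = card (C_set n b v w js)"
proof -
  \<comment> \<open>A path cannot stay more often than it has steps, so truncating the sum in
    \<open>p_poly\<close> loses nothing.\<close>
  have "C_set n b v w js = {}" if "length js < b"
  proof -
    have "card {j. j < length js \<and> P j} \<le> length js" for P
      using card_mono[of "{..<length js}" "{j. j < length js \<and> P j}"] by auto
    then have "card {j. j < length js \<and> P j} \<noteq> b" for P using that by (metis not_le)
    then show ?thesis unfolding C_set_def by simp
  qed
  moreover have "coeff (p_poly n v w js) b =
      (\<Sum>b' \<le> length js. if b' = b then card (C_set n b v w js) else 0)"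
    unfolding p_poly_def coeff_sum by (intro sum.cong) auto
  ultimately show ?thesis by (auto simp: not_le)
qed

lemma p_poly_Nil: "p_poly n v w [] = (if v = w then 1 else 0)"
  by (rule poly_eqI) (auto simp: coeff_p_poly C_set_Nil)

text \<open>The same recursion as for T_s T_v, with a stay contributing the factor
  \<open>q1\<close>. The two families of remaining paths are disjoint because they start at s_j v
  and at v.\<close>

lemma p_poly_Cons:
  assumes v: "v permutes {1..n}" and j: "j \<in> {1..<n}"
  shows "p_poly n v w (j # js) =
    p_poly n (adj j \<circ> v) w js + (if asc j v then 0 else pCons 0 (p_poly n v w js))"
proof (rule poly_eqI)
  fix b
  note bv = permutes_bij[OF v]
  let ?D = "{\<rho>. \<exists>b'. b = Suc b' \<and> \<rho> \<in> C_set n b' v w js}"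
  have D: "?D = (case b of 0 \<Rightarrow> {} | Suc b' \<Rightarrow> C_set n b' v w js)"
    by (auto split: nat.split)
  have "C_set n b (adj j \<circ> v) w js \<inter> ?D = {}"
    using adj_comp_neq[OF bv, of j] by (auto simp: C_set_def)
  moreover have "finite (C_set n b (adj j \<circ> v) w js)" "finite ?D"
    unfolding D by (auto intro!: finite_C_set adj_comp_bij bv split: nat.split)
  ultimately have "card (C_set n b (adj j \<circ> v) w js \<union> ?D) =
      card (C_set n b (adj j \<circ> v) w js) + card ?D"
    by (intro card_Un_disjoint)
  then show "coeff (p_poly n v w (j # js)) b =
      coeff (p_poly n (adj j \<circ> v) w js + (if asc j v then 0 else pCons 0 (p_poly n v w js))) b"
    unfolding coeff_p_poly C_set_Cons[OF bv] bruhat_less_adj_comp_iff[OF v j] D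
    by (auto simp: card_image coeff_p_poly coeff_pCons split: nat.split)
qed


section \<open>Straightening in the quotient\<close>

lemma one_line_in_range:
  assumes "u permutes {1..n}" "i \<in> {1..n}"
  shows "one_line u i \<in> {1..n}"
  unfolding one_line_def using permutes_in_image[OF permutes_inv[OF assms(1)]] assms(2) by blast

lemma row_col_subset:
  assumes "u permutes {1..n}" "v permutes {1..n}" "set is \<subseteq> {1..n}"
  shows "set (row_col u v is) \<subseteq> {1..n} \<times> {1..n}"
  using assms one_line_in_range by (auto simp: row_col_def simp del: atLeastAtMost_iff)

definition xfree :: "nat \<Rightarrow> (nat \<Rightarrow> nat) \<Rightarrow> (nat \<Rightarrow> nat) \<Rightarrow> free_alg" where
  "xfree n u v = Poly_Mapping.single (xword n u v) 1"

lemma xfree_in_free_ring: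
  assumes "u permutes {1..n}" "v permutes {1..n}"
  shows "xfree n u v \<in> carrier (free_ring n)"
  unfolding xfree_def xword_def
  by (intro single_in_free_ring row_col_subset assms) auto

text \<open>Only the factors at positions j and j+1 change, and the row indices of u ascend there.
  If the columns of v ascend too, the two factors commute; if they descend, the relation with the
  \<open>q1\<close> term applies, its extra product being the one for (u, v).\<close>

lemma xfree_adj_comp_cong:
  assumes u: "u permutes {1..n}" and v: "v permutes {1..n}"
    and j: "j \<in> {1..<n}" "asc j u"
  shows "xfree n (adj j \<circ> u) v -
    (xfree n u (adj j \<circ> v) + (if asc j v then 0 else const q1 * xfree n u v)) \<in> qmat_ideal n"
proof -
  note bu = permutes_bij[OF u] and bv = permutes_bij[OF v]
  interpret I: ideal "qmat_ideal n" "free_ring n" by (rule ideal_qmat_ideal)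
  let ?A = "Poly_Mapping.single (Word (row_col u v [1..<j])) 1 :: free_alg"
  let ?B = "Poly_Mapping.single (Word (row_col u v [Suc (Suc j)..<Suc n])) 1 :: free_alg"
  let ?a = "one_line u j" and ?b = "one_line u (Suc j)"
  let ?c = "one_line v j" and ?d = "one_line v (Suc j)"
  have ran: "?a \<in> {1..n}" "?b \<in> {1..n}" "?c \<in> {1..n}" "?d \<in> {1..n}"
    by (intro one_line_in_range u v; use j in auto)+
  have AB: "?A \<in> carrier (free_ring n)" "?B \<in> carrier (free_ring n)"
    by (intro single_in_free_ring row_col_subset u v; use j in auto)+
  have mem: "?A * f * ?B \<in> qmat_ideal n" if "f \<in> qmat_relators n" for f
    using I.I_r_closed[OF I.I_l_closed[OF relator_in_qmat_ideal[OF that] AB(1)] AB(2)] by simp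
  have x: "xfree n u v = ?A * (gen ?a ?c * gen ?b ?d) * ?B"
    "xfree n (adj j \<circ> u) v = ?A * (gen ?b ?c * gen ?a ?d) * ?B"
    "xfree n u (adj j \<circ> v) = ?A * (gen ?a ?d * gen ?b ?c) * ?B"
    unfolding xfree_def xword_split[OF j(1)]
    by (simp_all add: gen_def mult_single row_col_adj[OF bu bv] one_line_adj_comp[OF bu]
        one_line_adj_comp[OF bv] del: upt_Suc)
  have cx: "const q1 * xfree n u v = ?A * (const q1 * gen ?a ?c * gen ?b ?d) * ?B"
    unfolding x by (simp add: gen_def const_def mult_single del: upt_Suc)
  have ab: "?a < ?b" using j(2) by (simp add: asc_def)
  show ?thesis
  proof (cases "asc j v")
    case True
    then have "gen ?b ?c * gen ?a ?d - gen ?a ?d * gen ?b ?c \<in> qmat_relators n"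
      using ran ab unfolding qmat_relators_def asc_def by blast
    from mem[OF this] show ?thesis
      using True by (simp add: x algebra_simps del: upt_Suc)
  next
    case False
    have "?c \<noteq> ?d" using bij_one_line[OF bv] by (metis bij_is_inj inj_eq n_not_Suc_n)
    then have "?d < ?c" using False by (simp add: asc_def)
    then have "gen ?b ?c * gen ?a ?d -
        (gen ?a ?d * gen ?b ?c + const (qh - qh_inv) * gen ?a ?c * gen ?b ?d) \<in> qmat_relators n"
      using ran ab unfolding qmat_relators_def by blast
    from mem[OF this] show ?thesis
      using False cx unfolding q1_def[symmetric] x(2,3)
      by (simp add: algebra_simps del: upt_Suc)
  qed
qed

lemma const_add: "const (c + d) = const c + const d"
  by (simp add: const_def single_add)

lemma const_mult: "const (c * d) = const c * const d"
  by (simp add: const_def mult_single)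

lemma const_0 [simp]: "const 0 = 0"
  by (simp add: const_def)

lemma const_1 [simp]: "const 1 = 1"
  by (simp add: const_def flip: zero_fmonoid_def)

lemma sum_in_free_ring:
  "(\<And>a. a \<in> A \<Longrightarrow> f a \<in> carrier (free_ring n)) \<Longrightarrow> (\<Sum>a\<in>A. f a) \<in> carrier (free_ring n)"
proof (induction A rule: infinite_finite_induct)
  case (insert a A)
  then show ?case by (auto intro!: free_ring_closed)
qed (auto simp: free_ring_def)

lemma qmat_ideal_closed:
  shows "0 \<in> qmat_ideal n"
    and "f \<in> qmat_ideal n \<Longrightarrow> g \<in> qmat_ideal n \<Longrightarrow> f + g \<in> qmat_ideal n"
    and "f \<in> qmat_ideal n \<Longrightarrow> g \<in> qmat_ideal n \<Longrightarrow> f - g \<in> qmat_ideal n"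
    and "c \<in> carrier (free_ring n) \<Longrightarrow> f \<in> qmat_ideal n \<Longrightarrow> c * f \<in> qmat_ideal n"
proof -
  note add = ideal.axioms(1)[OF ideal_qmat_ideal[of n]]
  show "0 \<in> qmat_ideal n"
    using additive_subgroup.zero_closed[OF add] by simp
  show closed: "f + g \<in> qmat_ideal n" if "f \<in> qmat_ideal n" "g \<in> qmat_ideal n" for f g
    using additive_subgroup.a_closed[OF add that] by simp
  show "f - g \<in> qmat_ideal n" if "f \<in> qmat_ideal n" "g \<in> qmat_ideal n"
  proof -
    have "\<ominus>\<^bsub>free_ring n\<^esub> g \<in> qmat_ideal n"
      by (rule additive_subgroup.a_inv_closed[OF add that(2)])
    then have "- g \<in> qmat_ideal n"
      by (simp add: a_inv_free_ring additive_subgroup.a_Hcarr[OF add that(2)])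
    then show ?thesis using closed[OF that(1), of "- g"] by simp
  qed
  show "c * f \<in> qmat_ideal n" if "c \<in> carrier (free_ring n)" "f \<in> qmat_ideal n"
    using ideal.I_l_closed[OF ideal_qmat_ideal that(2,1)] by simp
qed

text \<open>Each letter of \<open>js\<close> is moved from the row permutation to the column
  permutation, and the expansions already known for s_j v and v combine by
  \<open>p_poly_Cons\<close>.\<close>

lemma xfree_expansion:
  assumes t: "t permutes {1..n}" and v: "v permutes {1..n}" and "set js \<subseteq> {1..<n}"
    and "card (inversions n (word_perm js \<circ> t)) = length js + card (inversions n t)"
  shows "xfree n (word_perm js \<circ> t) v -
    (\<Sum>w | w permutes {1..n}. const (eval_q1 (p_poly n v w js)) * xfree n t w) \<in> qmat_ideal n"
  using assms(2-4)
proof (induction js arbitrary: v)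
  case Nil
  have "(\<Sum>w | w permutes {1..n}. const (eval_q1 (p_poly n v w [])) * xfree n t w) =
      (\<Sum>w | w permutes {1..n}. if v = w then xfree n t w else 0)"
    by (intro sum.cong) (auto simp: p_poly_Nil)
  also have "\<dots> = xfree n t v"
    using Nil(1) finite_permutations[of "{1..n}"] by simp
  finally show ?case by (simp add: qmat_ideal_closed)
next
  case (Cons j js)
  let ?u = "word_perm js \<circ> t" and ?sv = "adj j \<circ> v"
  let ?S = "\<lambda>v js. \<Sum>w | w permutes {1..n}. const (eval_q1 (p_poly n v w js)) * xfree n t w"
  have js: "set js \<subseteq> {1..<n}" and j: "j \<in> {1..<n}" using Cons.prems by auto
  have v: "v permutes {1..n}" by (rule Cons.prems)
  have sv: "?sv permutes {1..n}" by (rule adj_comp_permutes[OF j v])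
  have u: "?u permutes {1..n}" by (rule permutes_compose[OF t word_perm_permutes[OF js]])
  have su: "word_perm (j # js) \<circ> t = adj j \<circ> ?u" by (simp only: word_perm_Cons comp_assoc)
  have c: "card (inversions n (adj j \<circ> ?u)) = Suc (length js) + card (inversions n t)"
    using Cons.prems(3) unfolding su by (simp only: list.size)
  have le: "card (inversions n ?u) \<le> length js + card (inversions n t)"
    by (rule card_inversions_word_perm_comp_le[OF js permutes_bij[OF t]])
  \<comment> \<open>The total length is additive and the tail cannot exceed its share, so the
    leading letter goes up.\<close>
  have a: "asc j ?u"
    using le c by (simp add: asc_iff_card_inversions[OF permutes_bij[OF u] j])
  have cu: "card (inversions n ?u) = length js + card (inversions n t)"
    using card_inversions_asc[OF permutes_bij[OF u] j a] c by simp
  have IH: "xfree n ?u w - ?S w js \<in> qmat_ideal n" if "w permutes {1..n}" for w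
    by (rule Cons.IH[OF that js cu])
  \<comment> \<open>A coefficient that may be 0 treats ascents and descents of v at once.\<close>
  let ?e = "if asc j v then 0 else q1"
  have S: "?S v (j # js) = ?S ?sv js + const ?e * ?S v js"
  proof -
    have "const (eval_q1 (p_poly n v w (j # js))) * xfree n t w =
        const (eval_q1 (p_poly n ?sv w js)) * xfree n t w +
        const ?e * (const (eval_q1 (p_poly n v w js)) * xfree n t w)" for w
      by (simp add: p_poly_Cons[OF v j] eval_q1_add eval_q1_pCons const_add const_mult
          distrib_right mult.assoc)
    then show ?thesis by (simp add: sum.distrib sum_distrib_left)
  qed
  have "xfree n (adj j \<circ> ?u) v - (xfree n ?u ?sv + const ?e * xfree n ?u v) \<in> qmat_ideal n"
    using xfree_adj_comp_cong[OF u v j a] by (auto split: if_splits)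
  moreover have "const ?e * (xfree n ?u v - ?S v js) \<in> qmat_ideal n"
    by (intro qmat_ideal_closed const_in_free_ring IH v)
  ultimately have "(xfree n (adj j \<circ> ?u) v - (xfree n ?u ?sv + const ?e * xfree n ?u v)) +
      (xfree n ?u ?sv - ?S ?sv js) + const ?e * (xfree n ?u v - ?S v js) \<in> qmat_ideal n"
    by (intro qmat_ideal_closed(2) IH sv)
  \<comment> \<open>The intermediate monomials in row permutation \<open>?u\<close> cancel.\<close>
  moreover have "(xfree n (adj j \<circ> ?u) v - (xfree n ?u ?sv + const ?e * xfree n ?u v)) +
      (xfree n ?u ?sv - ?S ?sv js) + const ?e * (xfree n ?u v - ?S v js) =
      xfree n (adj j \<circ> ?u) v - ?S v (j # js)"
    unfolding S by (simp only: right_diff_distrib) (simp only: algebra_simps)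
  ultimately show ?case by (simp only: su)
qed

text \<open>The functionals \<open>xword_coeff n x\<close> vanish on the ideal, so a relation modulo
  the ideal becomes, coefficient by coefficient, one in the Hecke algebra.\<close>

lemma xfree_independent:
  assumes t: "t permutes {1..n}"
    and mem: "(\<Sum>w | w permutes {1..n}. const (d w) * xfree n t w) \<in> qmat_ideal n"
    and w: "w permutes {1..n}"
  shows "d w = 0"
proof (rule hecke_pair_independent[OF t _ w])
  fix x
  have "lin_ext (xword_coeff n x) (const (d w) * xfree n t w) = d w * hecke_pair n t w x"
    if "w permutes {1..n}" for w
    using xword_coeff_xword[OF t that, of x]
    by (simp add: const_def xfree_def mult_single flip: zero_fmonoid_def)
  then have "(\<Sum>w | w permutes {1..n}. d w * hecke_pair n t w x) =
      lin_ext (xword_coeff n x) (\<Sum>w | w permutes {1..n}. const (d w) * xfree n t w)"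
    unfolding lin_ext_sum by (intro sum.cong) auto
  then show "(\<Sum>w | w permutes {1..n}. d w * hecke_pair n t w x) = 0"
    using lin_ext_qmat_ideal_eq_0[OF mem] by simp
qed

section \<open>Passage to the quotient ring and conclusion\<close>

abbreviation qclass :: "nat \<Rightarrow> free_alg \<Rightarrow> free_alg set" where
  "qclass n f \<equiv> qmat_ideal n +>\<^bsub>free_ring n\<^esub> f"

lemma qclass_hom: "qclass n \<in> ring_hom (free_ring n) (qmat n)"
  unfolding qmat_def by (rule ideal.rcos_ring_hom[OF ideal_qmat_ideal])

lemma qclass_eq_iff:
  assumes "f \<in> carrier (free_ring n)" "g \<in> carrier (free_ring n)"
  shows "qclass n f = qclass n g \<longleftrightarrow> f - g \<in> qmat_ideal n"
  using ring.quotient_eq_iff_same_a_r_cos[OF ring_free_ring ideal_qmat_ideal assms]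
  by (simp add: a_minus_free_ring[OF assms])

lemma qclass_mult:
  "f \<in> carrier (free_ring n) \<Longrightarrow> g \<in> carrier (free_ring n) \<Longrightarrow>
    qclass n f \<otimes>\<^bsub>qmat n\<^esub> qclass n g = qclass n (f * g)"
  using ring_hom_mult[OF qclass_hom, of f n g] by simp

lemma xmon_eq_qclass:
  assumes u: "u permutes {1..n}" and v: "v permutes {1..n}"
  shows "xmon n u v = qclass n (xfree n u v)"
proof -
  \<comment> \<open>Induction requires an arbitrary list of positions in place of 1..n.\<close>
  have "foldr (\<lambda>i a. qvar n (one_line u i) (one_line v i) \<otimes>\<^bsub>qmat n\<^esub> a) ps \<one>\<^bsub>qmat n\<^esub> =
      qclass n (Poly_Mapping.single (Word (row_col u v ps)) 1)" if "set ps \<subseteq> {1..n}" for ps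
    using that
  proof (induction ps)
    case Nil
    have "Poly_Mapping.single (Word []) 1 = (1 :: free_alg)" by (simp flip: zero_fmonoid_def)
    then show ?case using ring_hom_one[OF qclass_hom, of n] by (simp add: row_col_def)
  next
    case (Cons i ps)
    have i: "i \<in> {1..n}" and ps: "set ps \<subseteq> {1..n}" using Cons.prems by auto
    have "gen (one_line u i) (one_line v i) \<in> carrier (free_ring n)"
      by (intro gen_in_free_ring one_line_in_range u v i)
    moreover have "Poly_Mapping.single (Word (row_col u v ps)) 1 \<in> carrier (free_ring n)"
      by (intro single_in_free_ring row_col_subset u v ps)
    ultimately show ?case
      using Cons.IH[OF ps] qclass_mult[of "gen (one_line u i) (one_line v i)" n
          "Poly_Mapping.single (Word (row_col u v ps)) 1"]
      by (simp add: qvar_def gen_def mult_single row_col_def)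
  qed
  then show ?thesis
    unfolding xmon_def xfree_def xword_def
    by (simp only: set_upt atLeastLessThanSuc_atLeastAtMost order_refl)
qed

lemma finsum_qclass:
  assumes "finite A" "\<And>a. a \<in> A \<Longrightarrow> f a \<in> carrier (free_ring n)"
  shows "(\<Oplus>\<^bsub>qmat n\<^esub> a \<in> A. qclass n (f a)) = qclass n (\<Sum>a\<in>A. f a)"
proof -
  interpret Q: ring "qmat n"
    unfolding qmat_def by (rule ideal.quotient_is_ring[OF ideal_qmat_ideal])
  show ?thesis
    using assms
  proof (induction A)
    case empty
    show ?case using ring_hom_zero[OF qclass_hom ring_free_ring Q.ring_axioms] by simp
  next
    case (insert a A)
    have "(\<lambda>a. qclass n (f a)) \<in> A \<rightarrow> carrier (qmat n)" "qclass n (f a) \<in> carrier (qmat n)"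
      using insert.prems ring_hom_closed[OF qclass_hom] by auto
    moreover have "(\<Sum>a\<in>A. f a) \<in> carrier (free_ring n)"
      using insert.prems by (intro sum_in_free_ring) auto
    ultimately show ?case
      using insert ring_hom_add[OF qclass_hom, of "f a" n "\<Sum>a\<in>A. f a"]
      by (simp add: Q.finsum_insert)
  qed
qed

text \<open>Moves the equation defining \<open>r_poly\<close> from cosets to representatives, where
  existence and uniqueness become questions of ideal membership.\<close>

lemma xmon_expansion_iff:
  assumes u: "u permutes {1..n}" and v: "v permutes {1..n}" and t: "t permutes {1..n}"
  shows "xmon n u v = (\<Oplus>\<^bsub>qmat n\<^esub> w \<in> {w. w permutes {1..n}}. qscale n (c w) (xmon n t w)) \<longleftrightarrow>
    xfree n u v - (\<Sum>w | w permutes {1..n}. const (c w) * xfree n t w) \<in> qmat_ideal n"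
proof -
  interpret Q: ring "qmat n"
    unfolding qmat_def by (rule ideal.quotient_is_ring[OF ideal_qmat_ideal])
  have car: "const (c w) * xfree n t w \<in> carrier (free_ring n)" if "w permutes {1..n}" for w
    by (intro free_ring_closed const_in_free_ring xfree_in_free_ring t that)
  have "qscale n (c w) (xmon n t w) = qclass n (const (c w) * xfree n t w)"
    if "w permutes {1..n}" for w
    unfolding qscale_def xmon_eq_qclass[OF t that]
    by (intro qclass_mult const_in_free_ring xfree_in_free_ring t that)
  then have "(\<Oplus>\<^bsub>qmat n\<^esub> w \<in> {w. w permutes {1..n}}. qscale n (c w) (xmon n t w)) =
      (\<Oplus>\<^bsub>qmat n\<^esub> w \<in> {w. w permutes {1..n}}. qclass n (const (c w) * xfree n t w))"
    using car ring_hom_closed[OF qclass_hom] by (intro Q.finsum_cong') auto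
  also have "\<dots> = qclass n (\<Sum>w | w permutes {1..n}. const (c w) * xfree n t w)"
    using car by (intro finsum_qclass) (auto simp: finite_permutations)
  finally show ?thesis
    unfolding xmon_eq_qclass[OF u v]
    using car by (subst qclass_eq_iff[symmetric])
      (auto intro!: xfree_in_free_ring sum_in_free_ring u v)
qed

lemma r_poly_eq_p_poly:
  assumes t: "t permutes {1..n}" and u: "u permutes {1..n}" and tu: "weak_le n t u"
    and v: "v permutes {1..n}" and w: "w permutes {1..n}"
    and js: "reduced_expr n js (u \<circ> Hilbert_Choice.inv t)"
  shows "r_poly n u v t w = p_poly n v w js"
proof -
  let ?R = "\<lambda>r. (\<forall>w. \<not> w permutes {1..n} \<longrightarrow> r w = 0) \<and>
    xmon n u v =
      (\<Oplus>\<^bsub>qmat n\<^esub> w \<in> {w. w permutes {1..n}}. qscale n (eval_q1 (r w)) (xmon n t w))"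
  \<comment> \<open>Extended by 0 to meet the normalisation of \<open>r_poly\<close> off the
    symmetric group.\<close>
  let ?p = "\<lambda>w. if w permutes {1..n} then p_poly n v w js else 0"
  note e = xmon_expansion_iff[OF u v t]
  have "set js \<subseteq> {1..<n}" using js by (simp add: reduced_expr_iff expr_for_def)
  then have "xfree n u v -
      (\<Sum>w | w permutes {1..n}. const (eval_q1 (p_poly n v w js)) * xfree n t w) \<in> qmat_ideal n"
    using xfree_expansion[OF t v, of js] weak_le_card_inversions[OF tu js] by simp
  also have "(\<Sum>w | w permutes {1..n}. const (eval_q1 (p_poly n v w js)) * xfree n t w) =
      (\<Sum>w | w permutes {1..n}. const (eval_q1 (?p w)) * xfree n t w)"
    by (intro sum.cong) auto
  finally have p: "xfree n u v -
      (\<Sum>w | w permutes {1..n}. const (eval_q1 (?p w)) * xfree n t w) \<in> qmat_ideal n" .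
  have "r_poly n u v t = ?p"
    unfolding r_poly_def
  proof (rule the_equality)
    show "?R ?p" using p by (simp only: e) simp
  next
    fix r assume r: "?R r"
    \<comment> \<open>Subtracting two expansions cancels the monomial for (u, v) and leaves a
      relation among those with rows t. Independence then equates the evaluated coefficients, and
      \<open>eval_q1_inject\<close> the polynomials.\<close>
    have "(xfree n u v - (\<Sum>w | w permutes {1..n}. const (eval_q1 (?p w)) * xfree n t w)) -
        (xfree n u v - (\<Sum>w | w permutes {1..n}. const (eval_q1 (r w)) * xfree n t w)) \<in> qmat_ideal n"
      (is "?f - ?g \<in> _")
      by (rule qmat_ideal_closed(3)[OF p]) (use e[of "\<lambda>w. eval_q1 (r w)"] r in blast)
    also have "?f - ?g =
        (\<Sum>w | w permutes {1..n}. const (eval_q1 (r w) - eval_q1 (?p w)) * xfree n t w)"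
      by (simp add: const_def single_diff left_diff_distrib sum_subtractf)
    finally have "eval_q1 (r w) = eval_q1 (?p w)" if "w permutes {1..n}" for w
      using xfree_independent[OF t _ that, of "\<lambda>w. eval_q1 (r w) - eval_q1 (?p w)"] that
      by simp
    then have "r w = ?p w" for w
      using r eval_q1_inject[of "r w" "?p w"] by (cases "w permutes {1..n}") simp_all
    then show "r = ?p" by blast
  qed
  then show ?thesis using w by simp
qed

theorem theorem2p6:
  fixes n :: nat and t u :: "nat \<Rightarrow> nat"
  assumes "t permutes {1..n}" and "u permutes {1..n}" and "weak_le n t u"
  shows "(\<forall>v w js. v permutes {1..n} \<longrightarrow> w permutes {1..n} \<longrightarrow>
             reduced_expr n js (u \<circ> Hilbert_Choice.inv t) \<longrightarrow>
             r_poly n u v t w = p_poly n v w js) \<and>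
         (\<forall>v w js js'. v permutes {1..n} \<longrightarrow> w permutes {1..n} \<longrightarrow>
             reduced_expr n js (u \<circ> Hilbert_Choice.inv t) \<longrightarrow>
             reduced_expr n js' (u \<circ> Hilbert_Choice.inv t) \<longrightarrow>
             p_poly n v w js = p_poly n v w js')"
proof (intro conjI allI impI)
  fix v w js js'
  assume vw: "v permutes {1..n}" "w permutes {1..n}"
    and js: "reduced_expr n js (u \<circ> Hilbert_Choice.inv t)"
  note r = r_poly_eq_p_poly[OF assms vw]
  show "r_poly n u v t w = p_poly n v w js" by (rule r[OF js])
  show "p_poly n v w js = p_poly n v w js'"
    if "reduced_expr n js' (u \<circ> Hilbert_Choice.inv t)"
    by (rule trans[OF r[OF js, symmetric] r[OF that]])
qed

end
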